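(* Let $\Sigma$ be an $\bar o$-system of $s$ equations in the variables $X=\{x_1,\dots,x_n\}$ defining a diffiety in some neighborhood of a point $\eta$. Apply the procedure $\bar O$-test to the order matrix $A_\Sigma$, and let $p$ be its number of steps. Let $\Sigma=\bigcup_{h=1}^p\Sigma_h$ be the partition of the equations such that $\Sigma_{p-h+1}$ is the set of equations corresponding to the rows in $R_0$ at step $h$, and let $\Xi_{p-h+1}\subset X$ be the set of variables corresponding to the columns in $B$ and not in $C_0$ at step $h$, for $1\le h\le p$. If for all $1\le h\le p$ $$\mathrm{rank}\left(\frac{\partial P}{\partial x}(\eta)\ \Big|\ P\in\Sigma_h,\ x\in\Xi_h\right)=\sharp\Sigma_h,$$ then $\Sigma$ is $\bar o$-regular at $\eta$ (i.e. a regular $\bar o$-system at $\eta$).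
   Context: All functions are analytic. $\mathbf J(\mathbb R,\mathbb R^n)$ is the infinite jet space with coordinates $t$, $x_j^{(k)}$ ($1\le j\le n$, $k\in\mathbb N$) and derivation $d_t=\partial_t+\sum_{j,k}x_j^{(k+1)}\partial/\partial x_j^{(k)}$. A differential system $\Sigma=\{P_1,\dots,P_s\}$ is a finite set of differential functions (analytic functions of finitely many coordinates); near a point $\eta$ where all $d_t^kP_i$ vanish it defines a diffiety, the common zero set of all $d_t^kP_i$. Jacobi numbers. $\mathrm{ord}_{x_j}P$ is the largest $k$ such that $P$ depends on $x_j^{(k)}$, and $-\infty$ if there is none. The order matrix is $A_\Sigma=(a_{i,j})$, $a_{i,j}=\mathrm{ord}_{x_j}P_i$. For a set $Y$ of $s$ variables (columns), $\mathcal O_{Y,\Sigma}=\max_\sigma\sum_{i}a_{i,\sigma(i)}$ over bijections $\sigma:\{1,\dots,s\}\to Y$; $\hat{\mathcal O}_\Sigma=\min\{\mathcal O_{Y,\Sigma}:\sharp Y=s,\ \mathcal O_{Y,\Sigma}\ne-\infty\}$. $\Sigma$ is an $\bar o$-system if $\hat{\mathcal O}_\Sigma=0$. Regularity. For $Y$ with $\mathcal O_{Y,\Sigma}\ne-\infty$, a canon of $(a_{i,j})_{j\in Y}$ is $\ell\in\mathbb N^s$ such that for some bijection $\sigma_0:\{1,\dots,s\}\to Y$, $a_{i,\sigma_0(i)}+\ell_i=\max_{i'}(a_{i',\sigma_0(i)}+\ell_{i'})$ for all $i$; there is a unique componentwise minimal canon $\lambda$. With $\alpha_i=\max_k\lambda_k-\lambda_i$,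 $\beta_j=\max_i(a_{i,j}-\alpha_i)$, $\nabla_{Y,\Sigma}$ is the determinant of the matrix with entries ($j\in Y$) $\partial P_i/\partial x_j^{(a_{i,j})}$ if $a_{i,j}=\alpha_i+\beta_j$ and $0$ otherwise. An $\bar o$-system is ($\bar o$-)regular at $\eta$ if there is $Y$ with $\mathcal O_{Y,\Sigma}=0$ and $\nabla_{Y,\Sigma}(\eta)\ne0$. Covers. For a matrix $B$ with entries in $\{0,-\infty\}$ let $r$ be the maximal number of entries $0$ located in pairwise different rows and columns. Among the pairs $(R,C)$ of a set of rows and a set of columns with $\sharp R+\sharp C=r$ such that every entry $0$ lies in a row of $R$ or a column of $C$, there is a unique one $(R_0,C_0)$ with $R_0$ maximal and $C_0$ minimal for inclusion. Procedure $\bar O$-test on a matrix $A$ ($s$ rows, $n$ columns, entries in $\mathbb N\cup\{-\infty\}$): if $A$ has no rows, stop. If $s>n$ or some row contains no entry $0$, fail. Remove all columns containing only $-\infty$. Let $B$ be the submatrix of the columns containing only $0$ or $-\infty$ entries. Compute $(R_0,C_0)$ for $B$. If $R_0=\emptyset$, fail. Otherwise repeat (next step) with the matrix obtained from $A$ by deleting the rows in $R_0$. For an $\bar o$-system the procedure does not fail, and the sets $R_0$ of the successive steps partition the rows. *)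

theory Defs
  imports
    "HOL-Analysis.Analysis"
    "Jordan_Normal_Form.DL_Rank"
begin

hide_const (open) Determinants.det Finite_Cartesian_Product.mat Cartesian_Space.rank

section \<open>Jet space and differential functions\<close>

text \<open>
  The index type \<open>'n\<close> stands for the \<open>n\<close> variables, \<open>Var j k\<close> for the coordinate
  \<open>x\<^sub>j\<close> differentiated \<open>k\<close> times. The function space \<open>'n jet\<close> carries the product topology.
\<close>

datatype 'n jet_coord = Time | Var 'n nat

type_synonym 'n jet = "'n jet_coord \<Rightarrow> real"

definition pd :: "'n jet_coord \<Rightarrow> ('n jet \<Rightarrow> real) \<Rightarrow> 'n jet \<Rightarrow> real" where
  "pd c f \<xi> = deriv (\<lambda>v. f (\<xi>(c := v))) (\<xi> c)"

text \<open>
  Real analytic on \<open>U\<close> as a function of the coordinates in a finite set \<open>S\<close>: around every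
  point of \<open>U\<close> the function is the sum of a power series in those coordinates, the exponents
  \<open>m\<close> ranging over the multi-indices supported in \<open>S\<close>. That \<open>f\<close> depends on no coordinate
  outside \<open>S\<close> is part of this, since only the coordinates in \<open>S\<close> of \<open>\<xi>\<close> occur in the series
  and in the condition on \<open>\<xi>\<close>.
\<close>

definition differential_function :: "'n jet set \<Rightarrow> ('n jet \<Rightarrow> real) \<Rightarrow> bool" where
  "differential_function U f \<longleftrightarrow>
     (\<exists>S. finite S \<and>
        (\<forall>\<zeta>\<in>U. \<exists>r>0. \<exists>a :: ('n jet_coord \<Rightarrow> nat) \<Rightarrow> real.
           \<forall>\<xi>\<in>U. (\<forall>c\<in>S. \<bar>\<xi> c - \<zeta> c\<bar> < r) \<longrightarrow>
             ((\<lambda>m. a m * (\<Prod>c\<in>S. (\<xi> c - \<zeta> c) ^ m c)) has_sum f \<xi>) {m. \<forall>c. c \<notin> S \<longrightarrow> m c = 0}))"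

text \<open>The sum over \<open>k\<close> is restricted to the finitely many nonzero terms.\<close>

definition d_t :: "('n::finite jet \<Rightarrow> real) \<Rightarrow> 'n jet \<Rightarrow> real" where
  "d_t f \<xi> = pd Time f \<xi>
     + (\<Sum>j\<in>UNIV. \<Sum>k | pd (Var j k) f \<xi> \<noteq> 0. \<xi> (Var j (Suc k)) * pd (Var j k) f \<xi>)"

text \<open>
  A system is a family \<open>P 0, \<dots>, P (s - 1)\<close> of differential functions on an open set \<open>U\<close>;
  the values of the \<open>P i\<close> outside \<open>U\<close> are irrelevant.
\<close>

definition differential_system :: "'n jet set \<Rightarrow> nat \<Rightarrow> (nat \<Rightarrow> 'n jet \<Rightarrow> real) \<Rightarrow> bool" where
  "differential_system U s P \<longleftrightarrow> open U \<and> (\<forall>i<s. differential_function U (P i))"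

definition diffiety :: "'n::finite jet set \<Rightarrow> nat \<Rightarrow> (nat \<Rightarrow> 'n jet \<Rightarrow> real) \<Rightarrow> 'n jet set" where
  "diffiety U s P = {\<xi>\<in>U. \<forall>i<s. \<forall>k. (d_t ^^ k) (P i) \<xi> = 0}"

section \<open>Orders and Jacobi numbers\<close>

definition depends_on :: "'n jet set \<Rightarrow> ('n jet \<Rightarrow> real) \<Rightarrow> 'n jet_coord \<Rightarrow> bool" where
  "depends_on U f c \<longleftrightarrow> (\<exists>\<xi>\<in>U. \<exists>v. \<xi>(c := v) \<in> U \<and> f (\<xi>(c := v)) \<noteq> f \<xi>)"

definition max_deriv :: "'n jet set \<Rightarrow> ('n jet \<Rightarrow> real) \<Rightarrow> 'n \<Rightarrow> nat" where
  "max_deriv U f j = Max {k. depends_on U f (Var j k)}"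

definition jet_ord :: "'n jet set \<Rightarrow> ('n jet \<Rightarrow> real) \<Rightarrow> 'n \<Rightarrow> ereal" where
  "jet_ord U f j =
     (if \<exists>k. depends_on U f (Var j k) then ereal (real (max_deriv U f j)) else - \<infinity>)"

definition order_matrix ::
    "'n jet set \<Rightarrow> (nat \<Rightarrow> 'n jet \<Rightarrow> real) \<Rightarrow> nat \<Rightarrow> 'n \<Rightarrow> ereal" where
  "order_matrix U P i j = jet_ord U (P i) j"

definition bijections :: "nat \<Rightarrow> 'n set \<Rightarrow> (nat \<Rightarrow> 'n) set" where
  "bijections s Y = {\<sigma> \<in> {..<s} \<rightarrow>\<^sub>E Y. bij_betw \<sigma> {..<s} Y}"

definition jacobi_number :: "nat \<Rightarrow> (nat \<Rightarrow> 'n \<Rightarrow> ereal) \<Rightarrow> 'n set \<Rightarrow> ereal" where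
  "jacobi_number s A Y = Max ((\<lambda>\<sigma>. \<Sum>i<s. A i (\<sigma> i)) ` bijections s Y)"

text \<open>
  When no \<open>Y\<close> has a Jacobi number different from \<open>- \<infinity>\<close>, the minimum defining the
  saddle Jacobi number is empty; the value \<open>- \<infinity>\<close> excludes the system from the obar-systems.
\<close>

definition saddle_jacobi_number :: "nat \<Rightarrow> (nat \<Rightarrow> 'n \<Rightarrow> ereal) \<Rightarrow> ereal" where
  "saddle_jacobi_number s A =
     (let \<Y> = {Y. finite Y \<and> card Y = s \<and> jacobi_number s A Y \<noteq> - \<infinity>}
      in if \<Y> = {} then - \<infinity> else Min (jacobi_number s A ` \<Y>))"

definition obar_system :: "'n jet set \<Rightarrow> nat \<Rightarrow> (nat \<Rightarrow> 'n jet \<Rightarrow> real) \<Rightarrow> bool" where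
  "obar_system U s P \<longleftrightarrow> saddle_jacobi_number s (order_matrix U P) = 0"

section \<open>Canons, truncated determinant, regularity\<close>

text \<open>
  Tuples indexed by the rows are functions on \<open>nat\<close> that vanish from \<open>s\<close> on, which makes
  the minimal canon unique as a function.
\<close>

definition canon :: "nat \<Rightarrow> (nat \<Rightarrow> 'n \<Rightarrow> ereal) \<Rightarrow> 'n set \<Rightarrow> (nat \<Rightarrow> nat) \<Rightarrow> bool" where
  "canon s A Y l \<longleftrightarrow> (\<forall>i\<ge>s. l i = 0) \<and>
     (\<exists>\<sigma>\<in>bijections s Y. \<forall>i<s.
        A i (\<sigma> i) + ereal (real (l i)) = Max ((\<lambda>i'. A i' (\<sigma> i) + ereal (real (l i'))) ` {..<s}))"

definition minimal_canon :: "nat \<Rightarrow> (nat \<Rightarrow> 'n \<Rightarrow> ereal) \<Rightarrow> 'n set \<Rightarrow> nat \<Rightarrow> nat" where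
  "minimal_canon s A Y = (THE l. canon s A Y l \<and> (\<forall>l'. canon s A Y l' \<longrightarrow> (\<forall>i<s. l i \<le> l' i)))"

definition canon_alpha :: "nat \<Rightarrow> (nat \<Rightarrow> 'n \<Rightarrow> ereal) \<Rightarrow> 'n set \<Rightarrow> nat \<Rightarrow> nat" where
  "canon_alpha s A Y i = Max (minimal_canon s A Y ` {..<s}) - minimal_canon s A Y i"

definition canon_beta :: "nat \<Rightarrow> (nat \<Rightarrow> 'n \<Rightarrow> ereal) \<Rightarrow> 'n set \<Rightarrow> 'n \<Rightarrow> ereal" where
  "canon_beta s A Y j = Max ((\<lambda>i. A i j - ereal (real (canon_alpha s A Y i))) ` {..<s})"

definition nabla ::
    "'n::linorder jet set \<Rightarrow> nat \<Rightarrow> (nat \<Rightarrow> 'n jet \<Rightarrow> real) \<Rightarrow> 'n set \<Rightarrow> 'n jet \<Rightarrow> real" where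
  "nabla U s P Y \<eta> =
     (let A = order_matrix U P in
      det (mat s s (\<lambda>(i, k). let j = sorted_list_of_set Y ! k in
        if A i j = ereal (real (canon_alpha s A Y i)) + canon_beta s A Y j
        then pd (Var j (max_deriv U (P i) j)) (P i) \<eta> else 0)))"

definition obar_regular ::
    "'n::linorder jet set \<Rightarrow> nat \<Rightarrow> (nat \<Rightarrow> 'n jet \<Rightarrow> real) \<Rightarrow> 'n jet \<Rightarrow> bool" where
  "obar_regular U s P \<eta> \<longleftrightarrow> obar_system U s P \<and>
     (\<exists>Y. finite Y \<and> card Y = s \<and> jacobi_number s (order_matrix U P) Y = 0 \<and> nabla U s P Y \<eta> \<noteq> 0)"

section \<open>Covers of zero entries\<close>

text \<open>A matrix is given by its entries \<open>A\<close> together with its sets of rows and columns.\<close>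

definition zero_rank :: "('r \<Rightarrow> 'c \<Rightarrow> ereal) \<Rightarrow> 'r set \<Rightarrow> 'c set \<Rightarrow> nat" where
  "zero_rank A R C =
     Max (card ` {M. M \<subseteq> R \<times> C \<and> (\<forall>(i, j)\<in>M. A i j = 0) \<and> inj_on fst M \<and> inj_on snd M})"

definition minimal_cover ::
    "('r \<Rightarrow> 'c \<Rightarrow> ereal) \<Rightarrow> 'r set \<Rightarrow> 'c set \<Rightarrow> 'r set \<Rightarrow> 'c set \<Rightarrow> bool" where
  "minimal_cover A R C R' C' \<longleftrightarrow> R' \<subseteq> R \<and> C' \<subseteq> C \<and> card R' + card C' = zero_rank A R C \<and>
     (\<forall>i\<in>R. \<forall>j\<in>C. A i j = 0 \<longrightarrow> i \<in> R' \<or> j \<in> C')"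

definition row_maximal_cover ::
    "('r \<Rightarrow> 'c \<Rightarrow> ereal) \<Rightarrow> 'r set \<Rightarrow> 'c set \<Rightarrow> 'r set \<times> 'c set" where
  "row_maximal_cover A R C =
     (THE (R\<^sub>0, C\<^sub>0). minimal_cover A R C R\<^sub>0 C\<^sub>0 \<and>
        (\<nexists>R' C'. minimal_cover A R C R' C' \<and> R\<^sub>0 \<subset> R') \<and>
        (\<nexists>R' C'. minimal_cover A R C R' C' \<and> C' \<subset> C\<^sub>0))"

section \<open>The test\<close>

text \<open>
  The result \<open>None\<close> means failure. Otherwise the list contains, for each step in order, the
  set of rows \<open>R\<^sub>0\<close> and the set of columns of \<open>B\<close> that are not in \<open>C\<^sub>0\<close>.
\<close>

partial_function (option) obar_test ::
    "('r \<Rightarrow> 'c \<Rightarrow> ereal) \<Rightarrow> 'r set \<Rightarrow> 'c set \<Rightarrow> ('r set \<times> 'c set) list option" where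
  "obar_test A R C =
     (if R = {} then Some []
      else if card R > card C \<or> (\<exists>i\<in>R. \<forall>j\<in>C. A i j \<noteq> 0) then None
      else
        (let C' = {j\<in>C. \<exists>i\<in>R. A i j \<noteq> - \<infinity>};
             B = {j\<in>C'. \<forall>i\<in>R. A i j = 0 \<or> A i j = - \<infinity>};
             R\<^sub>0 = fst (row_maximal_cover A R B);
             C\<^sub>0 = snd (row_maximal_cover A R B)
         in if R\<^sub>0 = {} then None
            else Option.bind (obar_test A (R - R\<^sub>0) C') (\<lambda>steps. Some ((R\<^sub>0, B - C\<^sub>0) # steps))))"

definition obar_steps ::
    "'n::finite jet set \<Rightarrow> nat \<Rightarrow> (nat \<Rightarrow> 'n jet \<Rightarrow> real) \<Rightarrow> (nat set \<times> 'n set) list" where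
  "obar_steps U s P = the (obar_test (order_matrix U P) {..<s} UNIV)"

text \<open>
  The blocks are numbered from 1 in the order opposite to that of the steps, and the steps are
  listed from position 0, so that block \<open>h\<close> is found at position \<open>p - h\<close>.
\<close>

definition Sigma_block :: "('r set \<times> 'c set) list \<Rightarrow> nat \<Rightarrow> 'r set" where
  "Sigma_block steps h = fst (steps ! (length steps - h))"

definition Xi_block :: "('r set \<times> 'c set) list \<Rightarrow> nat \<Rightarrow> 'c set" where
  "Xi_block steps h = snd (steps ! (length steps - h))"

definition jacobian_rank ::
    "(nat \<Rightarrow> 'n::linorder jet \<Rightarrow> real) \<Rightarrow> nat set \<Rightarrow> 'n set \<Rightarrow> 'n jet \<Rightarrow> nat" where
  "jacobian_rank P R X \<eta> =
     vec_space.rank (card R) (mat (card R) (card X)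
       (\<lambda>(i, k). pd (Var (sorted_list_of_set X ! k) 0) (P (sorted_list_of_set R ! i)) \<eta>))"

end

theory Submission
  imports Defs "HOL-Combinatorics.Cycles"
begin

text \<open>
  The key notion is that of a tight potential: a choice \<open>\<sigma>\<close> of one zero of the order matrix in
  each row, in pairwise different columns, with numbers \<open>l\<close> on the rows such that
  \<open>a\<^bsub>i',\<sigma>(i)\<^esub> + l\<^bsub>i'\<^esub> \<le> l\<^bsub>i\<^esub>\<close>. It is a dual certificate: summing these inequalities
  along any bijection from the rows to \<open>Y = \<sigma>({1, \<dots>, s})\<close> shows that its order is at most \<open>0\<close>,
  so \<open>\<O>\<^bsub>Y\<^esub> = 0\<close>. The numbers \<open>l\<close> are a canon of \<open>A\<^bsub>Y\<^esub>\<close>, and all canons of \<open>A\<^bsub>Y\<^esub>\<close>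
  are of this kind.

  The truncated determinant is then a plain Jacobian. If a bijection \<open>\<tau>\<close> from the rows to \<open>Y\<close>
  meets no entry \<open>-\<infinity>\<close>, then it meets only zeros and is tight for the minimal canon as well, so
  \<open>\<alpha>\<^bsub>i\<^esub> + \<beta>\<^bsub>\<tau>(i)\<^esub> = 0\<close> and all its entries are kept by the truncation. If \<open>\<tau>\<close> meets \<open>-\<infinity>\<close>,
  then both the truncated matrix and the matrix \<open>J\<^bsub>Y\<^esub> = (\<partial>P\<^bsub>i\<^esub>/\<partial>x\<^bsub>j\<^esub>)\<^bsub>j \<in> Y\<^esub>\<close> have an entry \<open>0\<close> on
  \<open>\<tau>\<close>. Hence \<open>\<nabla>\<^bsub>Y\<^esub>(\<eta>) = det J\<^bsub>Y\<^esub>(\<eta>)\<close>, term by term in the Leibniz expansion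
  (\<open>nabla_eq_jacobian_det\<close>).

  It remains to find a tight potential with \<open>det J\<^bsub>Y\<^esub>(\<eta>) \<noteq> 0\<close>. The columns of \<open>B\<close> outside \<open>C\<^sub>0\<close>
  contain only \<open>0\<close> and \<open>-\<infinity>\<close> in the rows \<open>R\<^sub>0\<close>, and only \<open>-\<infinity>\<close> in the rows that are still
  to be treated. A minor of full size in each of the blocks, which exists by the rank hypothesis,
  therefore gives a block triangular \<open>J\<^bsub>Y\<^esub>\<close> with invertible diagonal blocks. A nonzero term of
  each minor provides the zeros \<open>\<sigma>\<close>, and \<open>l\<close> is obtained by raising the potential of the rows
  treated later above all entries in the rows of the current step (\<open>block_chain_nonsingular\<close>).

  The blocks are meaningful only if the test does not fail. An \<open>obar_system\<close> has a tight potential,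
  by a duality argument on walks in the graph of finite entries (\<open>tight_potential_exists\<close>). The
  rows where \<open>l\<close> is minimal have their zeros in columns of \<open>B\<close> without zeros in other rows, so they
  can be added to the rows of any minimal cover, and \<open>R\<^sub>0\<close> contains them
  (\<open>obar_test_succeeds\<close>). That \<open>R\<^sub>0\<close> is well defined rests on Koenig's theorem and on the
  lattice structure of the minimal covers.
\<close>

section \<open>Covers and matchings\<close>

definition covers :: "('r \<times> 'c) set \<Rightarrow> 'r set \<Rightarrow> 'c set \<Rightarrow> bool" where
  "covers E R C \<longleftrightarrow> (\<forall>e\<in>E. fst e \<in> R \<or> snd e \<in> C)"

definition matching :: "('r \<times> 'c) set \<Rightarrow> bool" where
  "matching M \<longleftrightarrow> inj_on fst M \<and> inj_on snd M"

lemma card_matching_le_cover: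
  assumes "finite R" "finite C" "matching M" "covers M R C"
  shows "card M \<le> card R + card C"
proof -
  let ?MR = "{e\<in>M. fst e \<in> R}" and ?MC = "{e\<in>M. snd e \<in> C}"
  have "card ?MR \<le> card R"
    using assms by (intro card_inj_on_le[of fst]) (auto simp: matching_def inj_on_def)
  moreover have "card ?MC \<le> card C"
    using assms by (intro card_inj_on_le[of snd]) (auto simp: matching_def inj_on_def)
  moreover have "M = ?MR \<union> ?MC"
    using assms(4) by (auto simp: covers_def)
  then have "card M = card (?MR \<union> ?MC)"
    by (rule arg_cong)
  then have "card M \<le> card ?MR + card ?MC"
    using card_Un_le[of ?MR ?MC] by linarith
  ultimately show ?thesis by linarith
qed

text \<open>
  The row sets of covers behave oppositely to the column sets; combining two covers in the two
  ways below preserves the total size, so covers of minimal size form a lattice.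
\<close>

lemma covers_lattice:
  assumes "covers E R1 C1" "covers E R2 C2"
  shows "covers E (R1 \<union> R2) (C1 \<inter> C2)" "covers E (R1 \<inter> R2) (C1 \<union> C2)"
  using assms by (auto simp: covers_def)

lemma card_lattice:
  assumes "finite R1" "finite C1" "finite R2" "finite C2"
  shows "(card (R1 \<union> R2) + card (C1 \<inter> C2)) + (card (R1 \<inter> R2) + card (C1 \<union> C2))
    = (card R1 + card C1) + (card R2 + card C2)"
  using card_Un_Int[OF assms(1,3)] card_Un_Int[OF assms(2,4)] by linarith

text \<open>
  Koenig's theorem. A set \<open>E\<close> without two positions in one line is a matching and is covered by its
  rows. If two positions \<open>e\<close> and \<open>f\<close> of \<open>E\<close> share a row or a column, it suffices to show
  that one of them can be dropped without lowering the minimal size of a cover. Otherwise small covers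
  of \<open>E - {e}\<close> and of \<open>E - {f}\<close> combine to two covers, one of which needs the shared line added; their
  total size is then too small for covers of \<open>E\<close>.
\<close>

lemma koenig_matching_cover:
  assumes "finite E"
  shows "\<exists>M R C. M \<subseteq> E \<and> matching M \<and> finite R \<and> finite C \<and> covers E R C \<and>
    card R + card C \<le> card M"
  using assms
proof (induction E rule: finite_psubset_induct)
  case (psubset E)
  show ?case
  proof (cases "matching E")
    case True
    then have "card (fst ` E) \<le> card E" "covers E (fst ` E) {}"
      by (auto simp: matching_def card_image covers_def)
    then show ?thesis
      using True psubset.hyps by (intro exI[of _ E] exI[of _ "fst ` E"] exI[of _ "{}"]) auto
  next
    case False
    then obtain e f where ef: "e \<in> E" "f \<in> E" "e \<noteq> f" and share: "fst e = fst f \<or> snd e = snd f"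
      by (auto simp: matching_def inj_on_def)
    obtain Me Re Ce where Me: "Me \<subseteq> E - {e}" "matching Me" "finite Re" "finite Ce"
        "covers (E - {e}) Re Ce" "card Re + card Ce \<le> card Me"
      using psubset.IH[of "E - {e}"] ef by auto
    obtain Mf Rf Cf where Mf: "Mf \<subseteq> E - {f}" "matching Mf" "finite Rf" "finite Cf"
        "covers (E - {f}) Rf Cf" "card Rf + card Cf \<le> card Mf"
      using psubset.IH[of "E - {f}"] ef by auto
    show ?thesis
    proof (rule ccontr)
      assume none: "\<not> ?thesis"
      \<comment> \<open>Were a cover of \<open>E\<close> as small as one of these matchings, the two would solve the problem.\<close>
      have big: "card Me < card R + card C" "card Mf < card R + card C"
        if "covers E R C" "finite R" "finite C" for R C
        using none that Me(1,2) Mf(1,2) by (metis Diff_subset leI order_trans)+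
      have ne: "\<not> covers E Re Ce"
        using big(1)[of Re Ce] Me by auto
      have nf: "\<not> covers E Rf Cf"
        using big(2)[of Rf Cf] Mf by auto
      have e: "fst e \<notin> Re" "snd e \<notin> Ce" "fst e \<in> Rf \<or> snd e \<in> Cf"
        using ne Me(5) Mf(5) ef by (auto simp: covers_def)
      have f: "fst f \<notin> Rf" "snd f \<notin> Cf" "fst f \<in> Re \<or> snd f \<in> Ce"
        using nf Me(5) Mf(5) ef by (auto simp: covers_def)
      have lat: "covers (E - {e, f}) (Re \<union> Rf) (Ce \<inter> Cf)" "covers (E - {e, f}) (Re \<inter> Rf) (Ce \<union> Cf)"
        using Me(5) Mf(5) by (auto simp: covers_def)
      have sum: "(card (Re \<union> Rf) + card (Ce \<inter> Cf)) + (card (Re \<inter> Rf) + card (Ce \<union> Cf))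
          \<le> card Me + card Mf"
        using card_lattice[OF Me(3,4) Mf(3,4)] Me(6) Mf(6) by linarith
      show False
      proof (cases "fst e = fst f")
        case True
        have "covers E (insert (fst e) (Re \<union> Rf)) (Ce \<inter> Cf)"
          using lat(1) True by (force simp: covers_def)
        moreover have "covers E (Re \<inter> Rf) (Ce \<union> Cf)"
          using lat(2) True e f by (force simp: covers_def)
        moreover have "card (insert (fst e) (Re \<union> Rf)) \<le> Suc (card (Re \<union> Rf))"
          by (simp add: card_insert_if Me Mf)
        ultimately show False
          using big[of "insert (fst e) (Re \<union> Rf)" "Ce \<inter> Cf"] big[of "Re \<inter> Rf" "Ce \<union> Cf"]
            sum Me(3,4) Mf(3,4) by simp
      next
        case False
        then have True: "snd e = snd f"
          using share by blast
        have "covers E (Re \<inter> Rf) (insert (snd e) (Ce \<union> Cf))"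
          using lat(2) True by (force simp: covers_def)
        moreover have "covers E (Re \<union> Rf) (Ce \<inter> Cf)"
          using lat(1) True e f by (force simp: covers_def)
        moreover have "card (insert (snd e) (Ce \<union> Cf)) \<le> Suc (card (Ce \<union> Cf))"
          by (simp add: card_insert_if Me Mf)
        ultimately show False
          using big[of "Re \<inter> Rf" "insert (snd e) (Ce \<union> Cf)"] big[of "Re \<union> Rf" "Ce \<inter> Cf"]
            sum Me(3,4) Mf(3,4) by simp
      qed
    qed
  qed
qed

section \<open>Minimal covers of the zeros\<close>

definition zero_positions :: "('r \<Rightarrow> 'c \<Rightarrow> ereal) \<Rightarrow> 'r set \<Rightarrow> 'c set \<Rightarrow> ('r \<times> 'c) set" where
  "zero_positions A R C = {e \<in> R \<times> C. A (fst e) (snd e) = 0}"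

lemma zero_rank_altdef:
  "zero_rank A R C = Max (card ` {M. M \<subseteq> zero_positions A R C \<and> matching M})"
proof -
  have "{M. M \<subseteq> R \<times> C \<and> (\<forall>(i, j)\<in>M. A i j = 0) \<and> inj_on fst M \<and> inj_on snd M}
    = {M. M \<subseteq> zero_positions A R C \<and> matching M}"
    by (auto simp: zero_positions_def matching_def)
  then show ?thesis
    unfolding zero_rank_def by (rule arg_cong)
qed

lemma minimal_cover_altdef:
  "minimal_cover A R C R' C' \<longleftrightarrow> R' \<subseteq> R \<and> C' \<subseteq> C \<and> card R' + card C' = zero_rank A R C \<and>
     covers (zero_positions A R C) R' C'"
  by (auto simp: minimal_cover_def covers_def zero_positions_def)

lemma finite_zero_positions: "finite R \<Longrightarrow> finite C \<Longrightarrow> finite (zero_positions A R C)"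
  by (simp add: zero_positions_def)

lemma zero_rank_le_cover:
  assumes "finite R" "finite C" "covers (zero_positions A R C) R' C'" "finite R'" "finite C'"
  shows "zero_rank A R C \<le> card R' + card C'"
proof -
  let ?Ms = "{M. M \<subseteq> zero_positions A R C \<and> matching M}"
  have "finite ?Ms"
    using finite_zero_positions[OF assms(1,2)] by (simp add: finite_subset[OF _ finite_Collect_subsets])
  moreover have "{} \<in> ?Ms"
    by (simp add: matching_def)
  moreover have "card M \<le> card R' + card C'" if "M \<in> ?Ms" for M
    using that assms by (intro card_matching_le_cover) (auto simp: covers_def)
  ultimately show ?thesis
    unfolding zero_rank_altdef by (subst Max_le_iff) auto
qed

lemma minimal_cover_exists:
  assumes "finite R" "finite C"
  shows "\<exists>R' C'. minimal_cover A R C R' C'"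
proof -
  let ?Z = "zero_positions A R C"
  obtain M R' C' where M: "M \<subseteq> ?Z" "matching M" "finite R'" "finite C'" "covers ?Z R' C'"
      "card R' + card C' \<le> card M"
    using koenig_matching_cover[OF finite_zero_positions[OF assms, of A]] by blast
  have cov: "covers ?Z (R' \<inter> R) (C' \<inter> C)"
    using M(5) by (auto simp: covers_def zero_positions_def)
  have "finite {M. M \<subseteq> ?Z \<and> matching M}"
    using finite_zero_positions[OF assms] by (simp add: finite_subset[OF _ finite_Collect_subsets])
  then have "card M \<le> zero_rank A R C"
    unfolding zero_rank_altdef using M(1,2) by (intro Max_ge) auto
  moreover have "card (R' \<inter> R) \<le> card R'" "card (C' \<inter> C) \<le> card C'"
    using M by (auto intro: card_mono)
  ultimately have "card (R' \<inter> R) + card (C' \<inter> C) = zero_rank A R C"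
    using zero_rank_le_cover[OF assms cov] M(3,4,6) by simp
  then show ?thesis
    using cov by (auto simp: minimal_cover_altdef intro!: exI[of _ "R' \<inter> R"] exI[of _ "C' \<inter> C"])
qed

lemma minimal_cover_lattice:
  assumes "finite R" "finite C" "minimal_cover A R C R1 C1" "minimal_cover A R C R2 C2"
  shows "minimal_cover A R C (R1 \<union> R2) (C1 \<inter> C2)"
proof -
  have fin: "finite R1" "finite C1" "finite R2" "finite C2"
    using assms finite_subset by (auto simp: minimal_cover_altdef)
  note cov = covers_lattice[of "zero_positions A R C" R1 C1 R2 C2]
  have c: "covers (zero_positions A R C) R1 C1" "covers (zero_positions A R C) R2 C2"
    using assms(3,4) by (simp_all add: minimal_cover_altdef)
  have "zero_rank A R C \<le> card (R1 \<union> R2) + card (C1 \<inter> C2)"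
    using cov(1)[OF c] fin by (intro zero_rank_le_cover assms) auto
  moreover have "zero_rank A R C \<le> card (R1 \<inter> R2) + card (C1 \<union> C2)"
    using cov(2)[OF c] fin by (intro zero_rank_le_cover assms) auto
  ultimately have "card (R1 \<union> R2) + card (C1 \<inter> C2) = zero_rank A R C"
    using card_lattice[OF fin] assms(3,4) by (simp add: minimal_cover_altdef)
  then show ?thesis
    using assms(3,4) cov(1)[OF c] by (auto simp: minimal_cover_altdef)
qed

text \<open>
  By the lattice structure, a maximal row set is the greatest one and its column set is the least
  one. Thus the definite description denotes, and maximality yields inclusions.
\<close>

lemma row_maximal_cover_greatest:
  assumes "finite R" "finite C"
  shows "minimal_cover A R C (fst (row_maximal_cover A R C)) (snd (row_maximal_cover A R C))"
    and "minimal_cover A R C R' C' \<Longrightarrow> R' \<subseteq> fst (row_maximal_cover A R C)"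
proof -
  let ?Rs = "{R'. \<exists>C'. minimal_cover A R C R' C'}"
  have "?Rs \<subseteq> Pow R" "?Rs \<noteq> {}"
    using minimal_cover_exists[OF assms, of A] by (auto simp: minimal_cover_altdef)
  then have "\<exists>R0\<in>?Rs. \<forall>R'\<in>?Rs. R0 \<subseteq> R' \<longrightarrow> R0 = R'"
    using assms(1) by (intro finite_has_maximal) (auto intro: finite_subset)
  then obtain R0 where R0: "R0 \<in> ?Rs" "\<And>R'. R' \<in> ?Rs \<Longrightarrow> R0 \<subseteq> R' \<Longrightarrow> R0 = R'"
    by metis
  then obtain C0 where m0: "minimal_cover A R C R0 C0"
    by auto
  have max: "R0 = R'" if "minimal_cover A R C R' C'" "R0 \<subseteq> R'" for R' C'
    using R0(2)[of R'] that by auto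
  have great: "R' \<subseteq> R0 \<and> C0 \<subseteq> C'" if m': "minimal_cover A R C R' C'" for R' C'
  proof -
    have m: "minimal_cover A R C (R0 \<union> R') (C0 \<inter> C')"
      by (rule minimal_cover_lattice[OF assms m0 m'])
    then have R: "R0 \<union> R' = R0"
      using max[of "R0 \<union> R'"] by blast
    have "card (C0 \<inter> C') = card C0"
      using m m0 unfolding R by (simp add: minimal_cover_altdef)
    moreover have "finite C0"
      using m0 assms(2) finite_subset by (auto simp: minimal_cover_altdef)
    ultimately have "C0 \<inter> C' = C0"
      by (intro card_subset_eq) auto
    then show ?thesis using R by blast
  qed
  have "row_maximal_cover A R C = (R0, C0)"
    unfolding row_maximal_cover_def
  proof (rule the_equality, goal_cases)
    case 1
    then show ?case using m0 great by auto
  next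
    case (2 x)
    obtain R1 C1 where x: "x = (R1, C1)" by fastforce
    have "R1 \<subseteq> R0" "C0 \<subseteq> C1"
      using great[of R1 C1] 2 x by auto
    moreover have "\<not> R1 \<subset> R0" "\<not> C0 \<subset> C1"
      using 2 x m0 by auto
    ultimately show ?case
      using x by auto
  qed
  then show "minimal_cover A R C (fst (row_maximal_cover A R C)) (snd (row_maximal_cover A R C))"
    and "minimal_cover A R C R' C' \<Longrightarrow> R' \<subseteq> fst (row_maximal_cover A R C)"
    using m0 great by auto
qed

section \<open>Tight potentials\<close>

definition order_entries :: "('r \<Rightarrow> 'c \<Rightarrow> ereal) \<Rightarrow> bool" where
  "order_entries A \<longleftrightarrow> (\<forall>i j. A i j = - \<infinity> \<or> (\<exists>k::nat. A i j = ereal (real k)))"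

lemma order_entriesE:
  assumes "order_entries A"
  obtains "A i j = - \<infinity>" | k :: nat where "A i j = ereal (real k)"
  using assms unfolding order_entries_def by blast

lemma order_entries_nonneg:
  "order_entries A \<Longrightarrow> A i j \<noteq> - \<infinity> \<Longrightarrow> 0 \<le> A i j"
  by (metis order_entriesE ereal_less_eq(5) of_nat_0_le_iff)

lemma order_entries_not_PInfty:
  "order_entries A \<Longrightarrow> A i j \<noteq> \<infinity>"
  by (rule order_entriesE[of A i j]) auto

lemma order_entries_bounded:
  assumes "order_entries A" "finite S"
  shows "\<exists>K::nat. \<forall>e\<in>S. A (f e) (g e) \<le> ereal (real K)"
  using assms(2)
proof induction
  case (insert e S)
  then obtain K :: nat where K: "\<And>e. e \<in> S \<Longrightarrow> A (f e) (g e) \<le> ereal (real K)"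
    by blast
  obtain k :: nat where k: "A (f e) (g e) \<le> ereal (real k)"
    by (rule order_entriesE[OF assms(1), of "f e" "g e"]) auto
  have "A (f e') (g e') \<le> ereal (real (max K k))" if "e' \<in> insert e S" for e'
    using that k K[of e'] by (auto simp: max_def intro: order_trans)
  then show ?case by blast
qed simp

text \<open>
  Once \<open>l\<close> is added to the rows, the zero that \<open>\<sigma>\<close> selects in a row is a maximum of its column: \<open>l\<close> is
  a canon, witnessed by \<open>\<sigma>\<close>. The rows are an arbitrary set because the test passes to submatrices.
\<close>

definition tight_potential ::
    "('r \<Rightarrow> 'c \<Rightarrow> ereal) \<Rightarrow> 'r set \<Rightarrow> ('r \<Rightarrow> 'c) \<Rightarrow> ('r \<Rightarrow> nat) \<Rightarrow> bool" where
  "tight_potential A R \<sigma> l \<longleftrightarrow> inj_on \<sigma> R \<and> (\<forall>i\<in>R. A i (\<sigma> i) = 0) \<and>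
     (\<forall>i\<in>R. \<forall>i'\<in>R. A i' (\<sigma> i) + ereal (real (l i')) \<le> ereal (real (l i)))"

lemma tight_potential_subset:
  "tight_potential A R \<sigma> l \<Longrightarrow> R' \<subseteq> R \<Longrightarrow> tight_potential A R' \<sigma> l"
  by (auto simp: tight_potential_def intro: inj_on_subset)

section \<open>The test\<close>

text \<open>
  The rows \<open>I\<close> contain all zeros of the columns \<open>\<sigma> ` I\<close>, so adding \<open>I\<close> to the rows makes these columns
  superfluous. This does not enlarge the cover: each row of \<open>I\<close> that is new had its zero \<open>\<sigma> i\<close>
  covered by a column.
\<close>

lemma minimal_cover_insert_closed_rows:
  assumes fin: "finite R" "finite C" and cov: "minimal_cover A R C R' C'"
    and I: "I \<subseteq> R" "inj_on \<sigma> I" "\<sigma> ` I \<subseteq> C" "\<And>i. i \<in> I \<Longrightarrow> A i (\<sigma> i) = 0"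
    and closed: "\<And>i i'. i \<in> I \<Longrightarrow> i' \<in> R \<Longrightarrow> A i' (\<sigma> i) = 0 \<Longrightarrow> i' \<in> I"
  shows "minimal_cover A R C (R' \<union> I) (C' - \<sigma> ` I)"
proof -
  have sub: "R' \<subseteq> R" "C' \<subseteq> C" "card R' + card C' = zero_rank A R C"
    and c: "covers (zero_positions A R C) R' C'"
    using cov by (auto simp: minimal_cover_altdef)
  have finI: "finite I" "finite R'" "finite C'"
    using sub I(1) fin by (auto intro: finite_subset)
  have c': "covers (zero_positions A R C) (R' \<union> I) (C' - \<sigma> ` I)"
    using c closed by (fastforce simp: covers_def zero_positions_def)
  have "\<sigma> ` (I - R') \<subseteq> C' \<inter> \<sigma> ` I"
  proof (rule image_subsetI)
    fix i assume i: "i \<in> I - R'"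
    then have "(i, \<sigma> i) \<in> zero_positions A R C"
      using I by (auto simp: zero_positions_def)
    then show "\<sigma> i \<in> C' \<inter> \<sigma> ` I"
      using c i by (auto simp: covers_def)
  qed
  then have "card (\<sigma> ` (I - R')) \<le> card (C' \<inter> \<sigma> ` I)"
    using finI by (intro card_mono) auto
  then have le: "card (I - R') \<le> card (C' \<inter> \<sigma> ` I)"
    using I(2) by (simp add: card_image inj_on_diff)
  have "card (R' \<union> I) = card R' + card (I - R')"
    using finI by (metis Un_Diff_cancel card_Un_disjoint Diff_disjoint finite_Diff)
  moreover have "card C' = card (C' - \<sigma> ` I) + card (C' \<inter> \<sigma> ` I)"
    using finI(3) by (metis card_Int_Diff add.commute)
  moreover have "zero_rank A R C \<le> card (R' \<union> I) + card (C' - \<sigma> ` I)"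
    using finI by (intro zero_rank_le_cover fin c') auto
  ultimately have "card (R' \<union> I) + card (C' - \<sigma> ` I) = zero_rank A R C"
    using le sub(3) by linarith
  then show ?thesis
    using sub I(1) c' by (auto simp: minimal_cover_altdef)
qed

text \<open>
  What the steps of the test say about \<open>A\<close>: each block has order at most zero in its own columns,
  and these columns are free of finite entries in the rows of all subsequent blocks.
\<close>

primrec block_chain :: "('r \<Rightarrow> 'c \<Rightarrow> ereal) \<Rightarrow> 'r set \<Rightarrow> ('r set \<times> 'c set) list \<Rightarrow> bool" where
  "block_chain A R [] \<longleftrightarrow> R = {}"
| "block_chain A R (b # bs) \<longleftrightarrow> fst b \<subseteq> R \<and> finite (snd b) \<and>
     (\<forall>i\<in>fst b. \<forall>j\<in>snd b. A i j = 0 \<or> A i j = - \<infinity>) \<and>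
     (\<forall>i\<in>R - fst b. \<forall>j\<in>snd b. A i j = - \<infinity>) \<and> block_chain A (R - fst b) bs"

text \<open>
  The rows of minimal potential have their zeros in columns of \<open>B\<close>, since in such a column any row with
  a finite entry also has minimal potential and the entry is \<open>0\<close>. They thus belong to \<open>R\<^sub>0\<close>, so each
  step removes a row, and the restriction of the potential serves for the remaining rows.
\<close>

lemma obar_test_succeeds:
  assumes "finite R" "finite C" "order_entries A" "tight_potential A R \<sigma> l" "\<sigma> ` R \<subseteq> C"
  shows "\<exists>steps. obar_test A R C = Some steps \<and> block_chain A R steps"
  using assms
proof (induction R arbitrary: C rule: finite_psubset_induct)
  case (psubset R)
  note entries = order_entriesE[OF psubset.prems(2)]
  have inj: "inj_on \<sigma> R" and zero: "\<And>i. i \<in> R \<Longrightarrow> A i (\<sigma> i) = 0"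
    and pot: "\<And>i i'. i \<in> R \<Longrightarrow> i' \<in> R \<Longrightarrow> A i' (\<sigma> i) + ereal (real (l i')) \<le> ereal (real (l i))"
    using psubset.prems(3) by (auto simp: tight_potential_def)
  show ?case
  proof (cases "R = {}")
    case True
    then show ?thesis by (simp add: obar_test.simps)
  next
    case False
    define C' where "C' = {j\<in>C. \<exists>i\<in>R. A i j \<noteq> - \<infinity>}"
    define B where "B = {j\<in>C'. \<forall>i\<in>R. A i j = 0 \<or> A i j = - \<infinity>}"
    define R0 where "R0 = fst (row_maximal_cover A R B)"
    define C0 where "C0 = snd (row_maximal_cover A R B)"
    define m where "m = Min (l ` R)"
    define I where "I = {i\<in>R. l i = m}"
    have finC: "finite C'" "finite B"
      using psubset.prems(1) by (auto simp: C'_def B_def)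
    have "m \<in> l ` R" and mle: "\<And>i. i \<in> R \<Longrightarrow> m \<le> l i"
      using False psubset.hyps by (auto simp: m_def intro: Min_in)
    then have I: "I \<noteq> {}" "I \<subseteq> R"
      by (auto simp: I_def)
    have \<sigma>C': "\<sigma> ` R \<subseteq> C'"
      using psubset.prems(4) zero by (force simp: C'_def)
    have column: "A i' (\<sigma> i) = - \<infinity> \<or> A i' (\<sigma> i) = 0 \<and> i' \<in> I" if "i \<in> I" "i' \<in> R" for i i'
    proof (cases rule: entries[of i' "\<sigma> i"])
      case 1
      then show ?thesis by simp
    next
      case (2 k)
      have "real k + real (l i') \<le> real (l i)"
        using pot[of i i'] that 2 I by auto
      moreover have "l i = m" "m \<le> l i'"
        using that mle by (auto simp: I_def)
      ultimately have "k = 0" "l i' = m"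
        by linarith+
      then show ?thesis
        using 2 that by (simp add: I_def zero_ereal_def)
    qed
    have \<sigma>B: "\<sigma> ` I \<subseteq> B"
      using \<sigma>C' I(2) column by (fastforce simp: B_def)
    have cov: "minimal_cover A R B R0 C0"
      unfolding R0_def C0_def by (rule row_maximal_cover_greatest(1)[OF psubset.hyps finC(2)])
    have "minimal_cover A R B (R0 \<union> I) (C0 - \<sigma> ` I)"
    proof (rule minimal_cover_insert_closed_rows[OF psubset.hyps finC(2) cov I(2) _ \<sigma>B])
      show "inj_on \<sigma> I" using inj I(2) by (rule inj_on_subset)
      show "A i (\<sigma> i) = 0" if "i \<in> I" for i using that I zero by blast
      show "i' \<in> I" if "i \<in> I" "i' \<in> R" "A i' (\<sigma> i) = 0" for i i' using column that by fastforce
    qed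
    from row_maximal_cover_greatest(2)[OF psubset.hyps finC(2) this] have "I \<subseteq> R0"
      unfolding R0_def by blast
    then have R0: "R0 \<noteq> {}" "R0 \<subseteq> R"
      using I(1) cov by (auto simp: minimal_cover_def)
    have "\<exists>steps. obar_test A (R - R0) C' = Some steps \<and> block_chain A (R - R0) steps"
      using R0 \<sigma>C' psubset.prems finC
      by (intro psubset.IH) (auto intro: tight_potential_subset)
    then obtain steps where steps: "obar_test A (R - R0) C' = Some steps"
        "block_chain A (R - R0) steps"
      by blast
    have "card R \<le> card C"
      using card_inj_on_le[OF inj psubset.prems(4,1)] .
    moreover have "\<not> (\<exists>i\<in>R. \<forall>j\<in>C. A i j \<noteq> 0)"
      using zero psubset.prems(4) by blast
    ultimately have "obar_test A R C = Some ((R0, B - C0) # steps)"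
      using False R0 steps
      by (subst obar_test.simps) (simp add: Let_def flip: C'_def B_def R0_def C0_def)
    moreover have "block_chain A R ((R0, B - C0) # steps)"
    proof -
      have "A i j = - \<infinity>" if "i \<in> R - R0" "j \<in> B - C0" for i j
      proof -
        have "A i j \<noteq> 0"
          using that cov unfolding minimal_cover_def by blast
        then show ?thesis using that by (auto simp: B_def)
      qed
      then show ?thesis
        using R0 finC steps(2) by (auto simp: B_def)
    qed
    ultimately show ?thesis by blast
  qed
qed

section \<open>Existence of a tight potential\<close>

lemma distinct_path_rtrancl:
  assumes "(x, y) \<in> r\<^sup>*"
  shows "\<exists>xs. distinct xs \<and> xs \<noteq> [] \<and> hd xs = x \<and> last xs = y \<and>
    (\<forall>m. Suc m < length xs \<longrightarrow> (xs ! m, xs ! Suc m) \<in> r)"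
  using assms
proof (induction rule: rtrancl_induct)
  case base
  then show ?case by (intro exI[of _ "[x]"]) auto
next
  case (step y z)
  then obtain xs where xs: "distinct xs" "xs \<noteq> []" "hd xs = x" "last xs = y"
      "\<And>m. Suc m < length xs \<Longrightarrow> (xs ! m, xs ! Suc m) \<in> r"
    by blast
  show ?case
  proof (cases "z \<in> set xs")
    case True
    then obtain k where k: "k < length xs" "xs ! k = z"
      by (auto simp: in_set_conv_nth)
    then have "min (length xs) (Suc k) = Suc k"
      by simp
    then show ?thesis
      using xs k by (intro exI[of _ "take (Suc k) xs"]) (auto simp: last_conv_nth hd_conv_nth)
  next
    case False
    have "(xs @ [z]) ! m = xs ! m" "Suc m = length xs \<Longrightarrow> xs ! m = y" if "m < length xs" for m
      using that xs(2,4) by (auto simp: nth_append last_conv_nth dest: sym)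
    then show ?thesis
      using xs False step.hyps(2)
      by (intro exI[of _ "xs @ [z]"]) (auto simp: nth_append less_Suc_eq)
  qed
qed

lemma cycle_of_list_nth:
  assumes "distinct xs" "m < length xs"
  shows "cycle_of_list xs (xs ! m) = xs ! (Suc m mod length xs)"
proof -
  have "map (cycle_of_list xs) xs = rotate1 xs"
    using cyclic_rotation[OF assms(1), of 1] by simp
  then show ?thesis
    using assms(2) by (metis nth_map nth_rotate1)
qed

lemma sum_nonneg_ereal_le_0:
  fixes a :: "'b \<Rightarrow> ereal"
  assumes "finite S" "\<And>i. i \<in> S \<Longrightarrow> 0 \<le> a i" "sum a S \<le> 0" "i \<in> S"
  shows "a i = 0"
  using assms by (metis sum_nonneg_0 sum_nonneg antisym)

text \<open>
  Duality for the assignment problem. Consider the graph with an edge from \<open>i'\<close> to \<open>i\<close> whenever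
  \<open>A i' (\<sigma> i)\<close> is finite. A cycle of this graph yields a permutation, so by optimality of \<open>\<sigma>\<close> all of its
  entries are zero. An edge of positive order therefore leads to a row with strictly more
  predecessors, and a large multiple of the number of predecessors is a potential.
\<close>

lemma tight_potential_exists:
  assumes entries: "order_entries A" and R: "finite R" and inj: "inj_on \<sigma> R"
    and zero: "\<And>i. i \<in> R \<Longrightarrow> A i (\<sigma> i) = 0"
    and max: "\<And>\<pi>. \<pi> permutes R \<Longrightarrow> (\<Sum>i\<in>R. A i (\<sigma> (\<pi> i))) \<le> 0"
  shows "\<exists>l. tight_potential A R \<sigma> l"
proof -
  define r where "r = {(i', i). i' \<in> R \<and> i \<in> R \<and> A i' (\<sigma> i) \<noteq> - \<infinity>}"
  note nonneg = order_entries_nonneg[OF entries]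
  have cycle: "A i' (\<sigma> i) = 0" if path: "(i, i') \<in> r\<^sup>*" and edge: "(i', i) \<in> r" for i i'
  proof -
    obtain xs where xs: "distinct xs" "xs \<noteq> []" "hd xs = i" "last xs = i'"
        "\<And>m. Suc m < length xs \<Longrightarrow> (xs ! m, xs ! Suc m) \<in> r"
      using distinct_path_rtrancl[OF path] by blast
    let ?\<pi> = "cycle_of_list xs"
    \<comment> \<open>The last row of the path returns to the first by the closing edge.\<close>
    have next_edge: "(xs ! m, ?\<pi> (xs ! m)) \<in> r" if "m < length xs" for m
    proof (cases "Suc m < length xs")
      case True
      then show ?thesis using xs by (simp add: cycle_of_list_nth)
    next
      case False
      then have m: "Suc m = length xs" "m = length xs - 1"
        using that by auto
      then have "xs ! m = i'"
        using xs(2,4) by (simp add: last_conv_nth)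
      moreover have "?\<pi> (xs ! m) = i"
        using cycle_of_list_nth[OF xs(1) that] xs(2,3) m(1) by (simp add: hd_conv_nth)
      ultimately show ?thesis using edge by simp
    qed
    then have in_r: "(k, ?\<pi> k) \<in> r" if "k \<in> set xs" for k
      using that by (auto simp: in_set_conv_nth)
    then have "set xs \<subseteq> R"
      by (auto simp: r_def)
    then have "?\<pi> permutes R"
      using cycle_permutes permutes_subset by blast
    moreover have "0 \<le> A k (\<sigma> (?\<pi> k))" if "k \<in> R" for k
      using that in_r[of k] zero[of k] id_outside_supp[of k xs] nonneg
      by (cases "k \<in> set xs") (auto simp: r_def)
    ultimately have z: "A k (\<sigma> (?\<pi> k)) = 0" if "k \<in> R" for k
      using max[of ?\<pi>] that R sum_nonneg_ereal_le_0[of R "\<lambda>k. A k (\<sigma> (?\<pi> k))"] by blast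
    have "?\<pi> i' = i"
    proof -
      have "i' = xs ! (length xs - 1)" "length xs - 1 < length xs" "Suc (length xs - 1) = length xs"
        using xs(2,4) by (auto simp: last_conv_nth)
      then show ?thesis
        using cycle_of_list_nth[OF xs(1), of "length xs - 1"] xs(2,3) by (simp add: hd_conv_nth)
    qed
    then show ?thesis
      using z[of i'] edge by (auto simp: r_def)
  qed
  have "\<exists>K::nat. \<forall>e\<in>R \<times> R. A (fst e) (\<sigma> (snd e)) \<le> ereal (real K)"
    using R by (intro order_entries_bounded[OF entries]) simp
  then obtain K :: nat where K: "\<And>i i'. i' \<in> R \<Longrightarrow> i \<in> R \<Longrightarrow> A i' (\<sigma> i) \<le> ereal (real K)"
    by force
  define pre where "pre i = {k\<in>R. (k, i) \<in> r\<^sup>*}" for i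
  define l where "l i = K * card (pre i)" for i
  have "A i' (\<sigma> i) + ereal (real (l i')) \<le> ereal (real (l i))" if i: "i \<in> R" "i' \<in> R" for i i'
  proof (cases rule: order_entriesE[OF entries, of i' "\<sigma> i"])
    case 1
    then show ?thesis by simp
  next
    case (2 k)
    then have edge: "(i', i) \<in> r"
      using i by (simp add: r_def)
    then have sub: "pre i' \<subseteq> pre i" and fin: "finite (pre i)"
      using R by (auto simp: pre_def)
    have "k + l i' \<le> l i"
    proof (cases "k = 0")
      case True
      then show ?thesis
        using card_mono[OF fin sub] by (simp add: l_def)
    next
      case False
      then have "(i, i') \<notin> r\<^sup>*"
        using cycle[OF _ edge] 2 by auto
      then have "i \<in> pre i - pre i'"
        using i by (simp add: pre_def)
      then have "pre i' \<subset> pre i" using sub by blast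
      then have "Suc (card (pre i')) \<le> card (pre i)"
        using psubset_card_mono[OF fin] by (simp add: Suc_leI)
      then have "K * Suc (card (pre i')) \<le> l i"
        unfolding l_def by (rule mult_le_mono2)
      moreover have "k \<le> K"
        using K[of i' i] i 2 by simp
      ultimately show ?thesis by (simp add: l_def)
    qed
    then show ?thesis
      using 2 by simp
  qed
  then show ?thesis
    using inj zero by (auto simp: tight_potential_def)
qed

section \<open>Jacobi numbers and canons\<close>

lemma sum_ereal_eq_MInfty:
  fixes a :: "'b \<Rightarrow> ereal"
  assumes "finite S" "i \<in> S" "a i = - \<infinity>" "\<And>i. i \<in> S \<Longrightarrow> a i \<noteq> \<infinity>"
  shows "sum a S = - \<infinity>"
proof -
  have "sum a (S - {i}) \<noteq> \<infinity>"
    using assms by (simp add: sum_Pinfty)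
  then show ?thesis
    using assms by (simp add: sum.remove[of S i])
qed

lemma restrict_permutation_bijections:
  assumes "\<sigma> \<in> bijections s Y" "\<pi> permutes {..<s}"
  shows "(\<lambda>i\<in>{..<s}. \<sigma> (\<pi> i)) \<in> bijections s Y"
proof -
  have "bij_betw (\<sigma> \<circ> \<pi>) {..<s} Y"
    using assms by (auto simp: bijections_def intro: bij_betw_trans permutes_imp_bij)
  then have "bij_betw (\<lambda>i\<in>{..<s}. \<sigma> (\<pi> i)) {..<s} Y"
    by (rule bij_betw_cong[THEN iffD1, rotated]) simp
  then show ?thesis
    by (auto simp: bijections_def bij_betw_def PiE_def)
qed

lemma finite_bijections: "finite Y \<Longrightarrow> finite (bijections s Y)"
  unfolding bijections_def by (rule finite_subset[of _ "{..<s} \<rightarrow>\<^sub>E Y"]) (auto intro: finite_PiE)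

lemma bijections_nonempty:
  assumes "finite Y" "card Y = s"
  shows "bijections s Y \<noteq> {}"
proof -
  obtain f where f: "bij_betw f {..<s} Y"
    using assms by (metis bij_betw_iff_card card_lessThan finite_lessThan)
  then have "bij_betw (\<lambda>i\<in>{..<s}. f i) {..<s} Y"
    by (rule bij_betw_cong[THEN iffD1, rotated]) simp
  then have "(\<lambda>i\<in>{..<s}. f i) \<in> bijections s Y"
    by (auto simp: bijections_def bij_betw_def PiE_def)
  then show ?thesis by blast
qed

lemma zero_sum_entries:
  fixes A :: "nat \<Rightarrow> 'c \<Rightarrow> ereal"
  assumes "order_entries A" "(\<Sum>i<s. A i (\<tau> i)) = 0" "i < s"
  shows "A i (\<tau> i) = 0"
proof -
  have "A i (\<tau> i) \<noteq> - \<infinity>" if "i < s" for i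
    using sum_ereal_eq_MInfty[of "{..<s}" i "\<lambda>i. A i (\<tau> i)"] that assms(2)
      order_entries_not_PInfty[OF assms(1)] by auto
  then show ?thesis
    using assms order_entries_nonneg[OF assms(1)]
    by (intro sum_nonneg_ereal_le_0[of "{..<s}" "\<lambda>i. A i (\<tau> i)"]) auto
qed

text \<open>
  The minimum is attained at a set of columns of Jacobi number \<open>0\<close>. A bijection that attains it
  has nonnegative entries of sum \<open>0\<close>, hence zeros only.
\<close>

lemma zero_saddle_number_tight_potential:
  fixes A :: "nat \<Rightarrow> 'c::finite \<Rightarrow> ereal"
  assumes entries: "order_entries A" and saddle: "saddle_jacobi_number s A = 0"
  shows "\<exists>\<sigma> l. tight_potential A {..<s} \<sigma> l"
proof -
  let ?Ys = "{Y. finite Y \<and> card Y = s \<and> jacobi_number s A Y \<noteq> - \<infinity>}"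
  have ne: "?Ys \<noteq> {}"
    using saddle by (auto simp: saddle_jacobi_number_def Let_def split: if_splits)
  then have "0 = Min (jacobi_number s A ` ?Ys)"
    using saddle by (simp add: saddle_jacobi_number_def Let_def split: if_splits)
  also have "\<dots> \<in> jacobi_number s A ` ?Ys"
    using ne by (intro Min_in) auto
  finally obtain Y where Y: "card Y = s" "jacobi_number s A Y = 0"
    by auto
  let ?sum = "\<lambda>\<sigma>. \<Sum>i<s. A i (\<sigma> i)"
  have fin: "finite (?sum ` bijections s Y)"
    by (simp add: finite_bijections)
  have "?sum ` bijections s Y \<noteq> {}"
    using bijections_nonempty[of Y s] Y by simp
  then have "0 \<in> ?sum ` bijections s Y"
    using Max_in[OF fin] Y(2) by (simp add: jacobi_number_def)
  then obtain \<sigma> where \<sigma>: "\<sigma> \<in> bijections s Y" "?sum \<sigma> = 0"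
    by auto
  have "(\<Sum>i<s. A i (\<sigma> (\<pi> i))) \<le> 0" if "\<pi> permutes {..<s}" for \<pi>
  proof -
    have "?sum (\<lambda>i\<in>{..<s}. \<sigma> (\<pi> i)) \<le> jacobi_number s A Y"
      unfolding jacobi_number_def
      using restrict_permutation_bijections[OF \<sigma>(1) that] by (intro Max_ge fin imageI)
    then show ?thesis using Y(2) by simp
  qed
  moreover have "inj_on \<sigma> {..<s}"
    using \<sigma>(1) by (auto simp: bijections_def bij_betw_def)
  ultimately have "\<exists>l. tight_potential A {..<s} \<sigma> l"
    using zero_sum_entries[OF entries \<sigma>(2)] by (intro tight_potential_exists[OF entries]) auto
  then show ?thesis by blast
qed

text \<open>
  Complementary slackness: \<open>A i (\<tau> i) + l i\<close> is at most \<open>l\<close> at the row whose zero lies in column \<open>\<tau> i\<close>.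
  Both sides run over the same values of \<open>l\<close>, and the entries are nonnegative, so every inequality
  is an equality and every entry is zero.
\<close>

lemma tight_potential_transfer:
  assumes entries: "order_entries A" and fin: "finite R" and tight: "tight_potential A R \<sigma> l"
    and \<tau>: "bij_betw \<tau> R (\<sigma> ` R)" "\<And>i. i \<in> R \<Longrightarrow> A i (\<tau> i) \<noteq> - \<infinity>"
  shows "tight_potential A R \<tau> l"
proof -
  define k where "k i = the_inv_into R \<sigma> (\<tau> i)" for i
  have inj: "inj_on \<sigma> R"
    and pot: "\<And>i i'. i \<in> R \<Longrightarrow> i' \<in> R \<Longrightarrow> A i' (\<sigma> i) + ereal (real (l i')) \<le> ereal (real (l i))"
    using tight by (auto simp: tight_potential_def)
  have "bij_betw (the_inv_into R \<sigma>) (\<sigma> ` R) R"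
    using inj by (simp add: bij_betw_the_inv_into inj_on_imp_bij_betw)
  from bij_betw_trans[OF \<tau>(1) this] have k: "bij_betw k R R"
    by (simp add: k_def[abs_def] comp_def)
  have \<sigma>k: "\<sigma> (k i) = \<tau> i" and kR: "k i \<in> R" if "i \<in> R" for i
    using that f_the_inv_into_f[OF inj, of "\<tau> i"] bij_betwE[OF \<tau>(1)] bij_betwE[OF k]
    by (auto simp: k_def)
  have "\<exists>a::nat. A i (\<tau> i) = ereal (real a)" if "i \<in> R" for i
    by (rule order_entriesE[OF entries, of i "\<tau> i"]) (use \<tau>(2)[OF that] in auto)
  then obtain a :: "_ \<Rightarrow> nat" where a: "\<And>i. i \<in> R \<Longrightarrow> A i (\<tau> i) = ereal (real (a i))"
    by metis
  have le: "a i + l i \<le> l (k i)" if "i \<in> R" for i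
    using pot[OF kR[OF that] that] that by (simp add: \<sigma>k a)
  have sum: "(\<Sum>i\<in>R. l (k i)) = (\<Sum>i\<in>R. l i)"
    by (rule sum.reindex_bij_betw[OF k])
  have sums: "(\<Sum>i\<in>R. a i + l i) = (\<Sum>i\<in>R. l (k i))"
    using sum_mono[of R "\<lambda>i. a i + l i" "\<lambda>i. l (k i)"] le
    by (intro antisym) (auto simp: sum sum.distrib)
  have eq: "a i + l i = l (k i)" if "i \<in> R" for i
    by (rule sum_mono_inv[OF sums le that fin])
  have "(\<Sum>i\<in>R. a i) = 0"
    using sums by (simp add: sum sum.distrib)
  then have a0: "a i = 0" if "i \<in> R" for i
    using that fin by simp
  have "A i' (\<tau> i) + ereal (real (l i')) \<le> ereal (real (l i))" if "i \<in> R" "i' \<in> R" for i i'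
    using pot[OF kR that(2), of i] that eq[of i] a0[of i] by (simp add: \<sigma>k)
  then show ?thesis
    using \<tau>(1) a a0 by (auto simp: tight_potential_def bij_betw_def)
qed

lemma tight_potential_bijections:
  assumes "tight_potential A {..<s} \<sigma> l"
  shows "(\<lambda>i\<in>{..<s}. \<sigma> i) \<in> bijections s (\<sigma> ` {..<s})" "card (\<sigma> ` {..<s}) = s"
proof -
  have inj: "inj_on \<sigma> {..<s}"
    using assms by (simp add: tight_potential_def)
  then show "card (\<sigma> ` {..<s}) = s"
    by (simp add: card_image)
  have "bij_betw (\<lambda>i\<in>{..<s}. \<sigma> i) {..<s} (\<sigma> ` {..<s})"
    using inj_on_imp_bij_betw[OF inj] by (rule bij_betw_cong[THEN iffD1, rotated]) simp
  then show "(\<lambda>i\<in>{..<s}. \<sigma> i) \<in> bijections s (\<sigma> ` {..<s})"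
    by (auto simp: bijections_def)
qed

text \<open>
  Bijections without entry \<open>-\<infinity>\<close> consist of zeros by the transfer of the potential.
\<close>

lemma jacobi_number_tight_potential:
  assumes entries: "order_entries A" and tight: "tight_potential A {..<s} \<sigma> l"
  shows "jacobi_number s A (\<sigma> ` {..<s}) = 0"
  unfolding jacobi_number_def
proof (rule Max_eqI)
  let ?B = "bijections s (\<sigma> ` {..<s})" and ?sum = "\<lambda>\<sigma>. \<Sum>i<s. A i (\<sigma> i)"
  show "finite (?sum ` ?B)"
    by (simp add: finite_bijections)
  have "?sum (\<lambda>i\<in>{..<s}. \<sigma> i) = 0"
    using tight by (intro sum.neutral) (auto simp: tight_potential_def)
  then show "0 \<in> ?sum ` ?B"
    using tight_potential_bijections(1)[OF tight] by (intro image_eqI) simp_all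
  fix y assume "y \<in> ?sum ` ?B"
  then obtain \<tau> where \<tau>: "bij_betw \<tau> {..<s} (\<sigma> ` {..<s})" and y: "y = ?sum \<tau>"
    by (auto simp: bijections_def)
  show "y \<le> 0"
  proof (cases "\<exists>i<s. A i (\<tau> i) = - \<infinity>")
    case True
    then show ?thesis
      unfolding y using order_entries_not_PInfty[OF entries]
      by (auto simp: sum_ereal_eq_MInfty[of "{..<s}" _ "\<lambda>i. A i (\<tau> i)"])
  next
    case False
    then have "tight_potential A {..<s} \<tau> l"
      using \<tau> by (intro tight_potential_transfer[OF entries _ tight]) auto
    then have "y = 0"
      unfolding y by (intro sum.neutral) (auto simp: tight_potential_def)
    then show ?thesis by simp
  qed
qed

text \<open>
  The column \<open>\<tau> i\<close> of a canon with bijection \<open>\<tau>\<close> contains a zero, so its maximum is finite, and \<open>\<tau>\<close> meets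
  only finite entries. Transferring the given potential to \<open>\<tau>\<close> shows that these are zeros; the
  canon, tight for \<open>\<tau>\<close>, is then transferred back to \<open>\<sigma>\<close>.
\<close>

lemma canon_iff_tight_potential:
  assumes entries: "order_entries A" and tight: "tight_potential A {..<s} \<sigma> l\<^sub>0"
  shows "canon s A (\<sigma> ` {..<s}) l \<longleftrightarrow> (\<forall>i\<ge>s. l i = 0) \<and> tight_potential A {..<s} \<sigma> l"
    (is "?canon \<longleftrightarrow> ?supp \<and> ?tight")
proof
  assume ?canon
  then obtain \<tau> where supp: ?supp and \<tau>: "bij_betw \<tau> {..<s} (\<sigma> ` {..<s})"
    and max: "\<And>i. i < s \<Longrightarrow> A i (\<tau> i) + ereal (real (l i))
      = Max ((\<lambda>i'. A i' (\<tau> i) + ereal (real (l i'))) ` {..<s})"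
    by (auto simp: canon_def bijections_def)
  have ge: "A i' (\<tau> i) + ereal (real (l i')) \<le> A i (\<tau> i) + ereal (real (l i))"
    if "i < s" "i' < s" for i i'
    unfolding max[OF that(1)] using that by (intro Max_ge) auto
  have fin: "A i (\<tau> i) \<noteq> - \<infinity>" if i: "i < s" for i
  proof -
    obtain k where "k < s" "\<tau> i = \<sigma> k"
      using \<tau> i by (auto simp: bij_betw_def)
    then have "A k (\<tau> i) = 0" "k < s"
      using tight by (auto simp: tight_potential_def)
    then show ?thesis
      using ge[OF i, of k] by auto
  qed
  have "tight_potential A {..<s} \<tau> l\<^sub>0"
    using \<tau> fin by (intro tight_potential_transfer[OF entries _ tight]) auto
  then have tight': "tight_potential A {..<s} \<tau> l"
    using ge by (auto simp: tight_potential_def)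
  have "bij_betw \<sigma> {..<s} (\<tau> ` {..<s})"
    using \<tau> tight by (auto simp: bij_betw_def tight_potential_def)
  then have ?tight
    using tight by (intro tight_potential_transfer[OF entries _ tight']) (auto simp: tight_potential_def)
  with supp show "?supp \<and> ?tight" ..
next
  assume r: "?supp \<and> ?tight"
  have "A i (\<sigma> i) + ereal (real (l i)) = Max ((\<lambda>i'. A i' (\<sigma> i) + ereal (real (l i'))) ` {..<s})"
    if "i < s" for i
    using r that
    by (intro Max_eqI[symmetric]) (auto simp: tight_potential_def intro!: image_eqI[of _ _ i])
  then show ?canon
    using r tight_potential_bijections(1)[OF tight]
    by (auto simp: canon_def intro!: bexI[of _ "\<lambda>i\<in>{..<s}. \<sigma> i"])
qed

text \<open>
  The inequalities of a tight potential survive componentwise minima, so the pointwise minimum of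
  all canons is a canon, and the definite description denotes it.
\<close>

lemma minimal_canon_tight_potential:
  assumes entries: "order_entries A" and tight: "tight_potential A {..<s} \<sigma> l\<^sub>0"
  shows "tight_potential A {..<s} \<sigma> (minimal_canon s A (\<sigma> ` {..<s}))"
proof -
  let ?canon = "canon s A (\<sigma> ` {..<s})"
  note canon_iff = canon_iff_tight_potential[OF assms]
  define L where "L i = (if i < s then LEAST m. \<exists>l. ?canon l \<and> l i = m else 0)" for i
  have "?canon (\<lambda>i. if i < s then l\<^sub>0 i else 0)"
    unfolding canon_iff using tight by (auto simp: tight_potential_def)
  then have ex: "\<exists>m l. ?canon l \<and> l i = m" for i
    by blast
  have attained: "\<exists>l. ?canon l \<and> l i = L i" if "i < s" for i
    using LeastI_ex[OF ex[of i]] that by (simp add: L_def)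
  have least: "L i \<le> l i" if "?canon l" for i l
    using that by (auto simp: L_def intro: Least_le)
  have "A i' (\<sigma> i) + ereal (real (L i')) \<le> ereal (real (L i))" if i: "i < s" "i' < s" for i i'
  proof -
    obtain l where l: "?canon l" "l i = L i"
      using attained[OF i(1)] by blast
    have "A i' (\<sigma> i) + ereal (real (L i')) \<le> A i' (\<sigma> i) + ereal (real (l i'))"
      using least[OF l(1)] by (intro add_left_mono) simp
    also have "\<dots> \<le> ereal (real (l i))"
      using l(1) i unfolding canon_iff by (auto simp: tight_potential_def)
    finally show ?thesis using l(2) by simp
  qed
  then have L: "?canon L"
    unfolding canon_iff using tight by (auto simp: tight_potential_def L_def)
  have "?canon (minimal_canon s A (\<sigma> ` {..<s})) \<and>
      (\<forall>l'. ?canon l' \<longrightarrow> (\<forall>i<s. minimal_canon s A (\<sigma> ` {..<s}) i \<le> l' i))"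
    unfolding minimal_canon_def
  proof (rule theI[where a = L])
    show "?canon L \<and> (\<forall>l'. ?canon l' \<longrightarrow> (\<forall>i<s. L i \<le> l' i))"
      using L least by blast
    fix l assume l: "?canon l \<and> (\<forall>l'. ?canon l' \<longrightarrow> (\<forall>i<s. l i \<le> l' i))"
    then have "l i = L i" for i
      using l L least[of l i] unfolding canon_iff by (cases "i < s") (auto intro!: antisym)
    then show "l = L" by blast
  qed
  then show ?thesis
    unfolding canon_iff by blast
qed

text \<open>
  This amounts to \<open>\<alpha>\<^bsub>i\<^esub> + \<beta>\<^bsub>\<tau>(i)\<^esub> = 0\<close>, so that the truncation keeps the zeros on every tight transversal.
\<close>

lemma canon_beta_tight:
  assumes tight: "tight_potential A {..<s} \<tau> (minimal_canon s A Y)" and i: "i < s"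
  shows "canon_beta s A Y (\<tau> i) = - ereal (real (canon_alpha s A Y i))"
  unfolding canon_beta_def
proof (rule Max_eqI)
  let ?l = "minimal_canon s A Y" and ?\<alpha> = "canon_alpha s A Y"
  let ?\<Lambda> = "Max (?l ` {..<s})"
  have \<alpha>: "real (?\<alpha> i) = real ?\<Lambda> - real (?l i)" if "i < s" for i
    using that by (simp add: canon_alpha_def of_nat_diff)
  show "finite ((\<lambda>i'. A i' (\<tau> i) - ereal (real (?\<alpha> i'))) ` {..<s})"
    by simp
  show "- ereal (real (?\<alpha> i)) \<in> (\<lambda>i'. A i' (\<tau> i) - ereal (real (?\<alpha> i'))) ` {..<s}"
    using tight i by (intro image_eqI[of _ _ i]) (auto simp: tight_potential_def)
  fix y assume "y \<in> (\<lambda>i'. A i' (\<tau> i) - ereal (real (?\<alpha> i'))) ` {..<s}"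
  then obtain i' where i': "i' < s" "y = A i' (\<tau> i) - ereal (real (?\<alpha> i'))"
    by auto
  have "A i' (\<tau> i) + ereal (real (?l i')) \<le> ereal (real (?l i))"
    using tight i i' by (auto simp: tight_potential_def)
  then show "y \<le> - ereal (real (?\<alpha> i))"
    unfolding i'(2) \<alpha>[OF i] \<alpha>[OF i'(1)] by (cases "A i' (\<tau> i)") auto
qed

section \<open>Minors of full size\<close>

abbreviation block_mat ::
    "('r::linorder \<Rightarrow> 'c::linorder \<Rightarrow> real) \<Rightarrow> 'r set \<Rightarrow> 'c set \<Rightarrow> real mat" where
  "block_mat D R X \<equiv> mat (card R) (card X)
     (\<lambda>(i, k). D (sorted_list_of_set R ! i) (sorted_list_of_set X ! k))"

lemma bij_betw_sorted_list_of_set: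
  "finite X \<Longrightarrow> bij_betw (\<lambda>k. sorted_list_of_set X ! k) {..<card X} X"
  by (rule bij_betw_nth) auto

lemma block_mat_mult_vec:
  assumes "finite X" "i < card R"
  shows "(block_mat D R X *\<^sub>v vec (card X) (\<lambda>k. f (sorted_list_of_set X ! k))) $ i
    = (\<Sum>j\<in>X. D (sorted_list_of_set R ! i) j * f j)"
proof -
  have "(block_mat D R X *\<^sub>v vec (card X) (\<lambda>k. f (sorted_list_of_set X ! k))) $ i
      = (\<Sum>k<card X. D (sorted_list_of_set R ! i) (sorted_list_of_set X ! k) * f (sorted_list_of_set X ! k))"
    using assms(2) by (simp add: scalar_prod_def atLeast0LessThan)
  also have "\<dots> = (\<Sum>j\<in>X. D (sorted_list_of_set R ! i) j * f j)"
    by (rule sum.reindex_bij_betw[OF bij_betw_sorted_list_of_set[OF assms(1)]])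
  finally show ?thesis .
qed

text \<open>
  The kernel, unlike the determinant, does not depend on the enumeration of rows and columns. This
  turns the product formula for block triangular determinants into an elementary elimination.
\<close>

lemma det_block_mat_iff_kernel:
  assumes "finite R" "finite Y" "card Y = card R"
  shows "det (block_mat D R Y) \<noteq> 0 \<longleftrightarrow>
    (\<forall>v. (\<forall>i\<in>R. (\<Sum>j\<in>Y. D i j * v j) = 0) \<longrightarrow> (\<forall>j\<in>Y. v j = 0))"
proof -
  let ?M = "block_mat D R Y" and ?y = "\<lambda>k. sorted_list_of_set Y ! k" and ?n = "card R"
  have M: "?M \<in> carrier_mat ?n ?n"
    using assms(3) by simp
  have y: "bij_betw ?y {..<?n} Y"
    using bij_betw_sorted_list_of_set[OF assms(2)] assms(3) by simp
  have r: "bij_betw (\<lambda>k. sorted_list_of_set R ! k) {..<?n} R"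
    by (rule bij_betw_sorted_list_of_set[OF assms(1)])
  define w where "w v = vec ?n (\<lambda>k. v (?y k))" for v :: "'b \<Rightarrow> real"
  have w_surj: "\<exists>v. w v = x" if "x \<in> carrier_vec ?n" for x
  proof
    show "w (\<lambda>j. x $ the_inv_into {..<?n} ?y j) = x"
      using that y by (intro eq_vecI) (auto simp: w_def the_inv_into_f_f bij_betw_def)
  qed
  have w_zero: "w v = 0\<^sub>v ?n \<longleftrightarrow> (\<forall>j\<in>Y. v j = 0)" for v
  proof -
    have "w v = 0\<^sub>v ?n \<longleftrightarrow> (\<forall>k\<in>{..<?n}. v (?y k) = 0)"
      by (auto simp: w_def vec_eq_iff)
    also have "\<dots> \<longleftrightarrow> (\<forall>j\<in>?y ` {..<?n}. v j = 0)"
      by blast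
    finally show ?thesis
      unfolding bij_betw_imp_surj_on[OF y] .
  qed
  have Mw_zero: "?M *\<^sub>v w v = 0\<^sub>v ?n \<longleftrightarrow> (\<forall>i\<in>R. (\<Sum>j\<in>Y. D i j * v j) = 0)" for v
  proof -
    have "?M *\<^sub>v w v = 0\<^sub>v ?n
        \<longleftrightarrow> (\<forall>k\<in>{..<?n}. (\<Sum>j\<in>Y. D (sorted_list_of_set R ! k) j * v j) = 0)"
      using block_mat_mult_vec[OF assms(2), of _ R D v] assms(3)
      by (auto simp: w_def vec_eq_iff simp del: index_mult_mat_vec)
    also have "\<dots> \<longleftrightarrow> (\<forall>i\<in>(\<lambda>k. sorted_list_of_set R ! k) ` {..<?n}. (\<Sum>j\<in>Y. D i j * v j) = 0)"
      by blast
    finally show ?thesis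
      unfolding bij_betw_imp_surj_on[OF r] .
  qed
  have wc: "w v \<in> carrier_vec ?n" for v
    by (simp add: w_def)
  have "det ?M = 0 \<longleftrightarrow> (\<exists>v. w v \<noteq> 0\<^sub>v ?n \<and> ?M *\<^sub>v w v = 0\<^sub>v ?n)"
    unfolding det_0_iff_vec_prod_zero_field[OF M] using w_surj wc by metis
  then show ?thesis
    unfolding w_zero Mw_zero by blast
qed

text \<open>
  A maximal independent set of columns has as many elements as there are rows.
\<close>

lemma full_row_rank_minor:
  assumes "finite R" "finite X" and rank: "vec_space.rank (card R) (block_mat D R X) = card R"
  shows "\<exists>Y\<subseteq>X. card Y = card R \<and> det (block_mat D R Y) \<noteq> 0"
proof -
  interpret vec_space "TYPE(real)" "card R" .
  let ?M = "block_mat D R X"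
  define c where "c j = vec (card R) (\<lambda>i. D (sorted_list_of_set R ! i) j)" for j
  have cols: "cols (block_mat D R Z) = map c (sorted_list_of_set Z)" for Z
    by (intro nth_equalityI eq_vecI) (auto simp: c_def)
  have M: "?M \<in> carrier_mat (card R) (card X)"
    by simp
  obtain S where S: "maximal S (\<lambda>T. T \<subseteq> set (cols ?M) \<and> lin_indpt T)"
    using maximal_exists[of "\<lambda>T. T \<subseteq> set (cols ?M) \<and> lin_indpt T" "card (set (cols ?M))" "{}"]
    by (meson List.finite_set card_mono empty_iff empty_subsetI finite_lin_indpt2 rev_finite_subset)
  then have "card S = card R" and indpt: "lin_indpt S" and "S \<subseteq> c ` X"
    using rank_card_indpt[OF M S] rank assms(2) cols[of X] by (auto simp: maximal_def)
  then obtain Y where Y: "Y \<subseteq> X" "inj_on c Y" "S = c ` Y"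
    by (auto simp: subset_image_inj)
  then have card: "card Y = card R" and fin: "finite Y"
    using \<open>card S = card R\<close> assms(2) by (auto simp: card_image intro: finite_subset)
  let ?N = "block_mat D R Y"
  have N: "?N \<in> carrier_mat (card R) (card R)"
    using card by simp
  have "distinct (cols ?N)" "set (cols ?N) = S"
    unfolding cols using Y fin by (simp_all add: distinct_map)
  then have "rank ?N = card R"
    using lin_indpt_full_rank[OF N] indpt by simp
  then show ?thesis
    using det_rank_iff[OF N] Y(1) card by blast
qed

lemma nonzero_transversal:
  assumes "finite R" "finite Y" "card Y = card R" "det (block_mat D R Y) \<noteq> 0"
  shows "\<exists>\<sigma>. bij_betw \<sigma> R Y \<and> (\<forall>i\<in>R. D i (\<sigma> i) \<noteq> 0)"
proof -
  let ?n = "card R" and ?r = "\<lambda>k. sorted_list_of_set R ! k" and ?y = "\<lambda>k. sorted_list_of_set Y ! k"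
  have "(\<Sum>p | p permutes {0..<?n}. signof p * (\<Prod>i = 0..<?n. block_mat D R Y $$ (i, p i))) \<noteq> 0"
    using assms(3,4) by (simp add: det_def)
  then obtain p where "p \<in> {p. p permutes {0..<?n}}"
      and nz: "signof p * (\<Prod>i = 0..<?n. block_mat D R Y $$ (i, p i)) \<noteq> 0"
    by (rule sum.not_neutral_contains_not_neutral)
  then have p: "p permutes {0..<?n}"
    by simp
  have pn: "p i < ?n" if "i < ?n" for i
    using permutes_in_image[OF p, of i] that by simp
  have nz: "D (?r i) (?y (p i)) \<noteq> 0" if "i < ?n" for i
    using nz that pn[OF that] assms(3) by (auto dest!: bspec[of _ _ i])
  have r: "bij_betw ?r {..<?n} R" and y: "bij_betw ?y {..<?n} Y"
    using bij_betw_sorted_list_of_set[of R] bij_betw_sorted_list_of_set[of Y] assms by simp_all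
  have "bij_betw p {..<?n} {..<?n}"
    using permutes_imp_bij[OF p] by (simp add: atLeast0LessThan)
  from bij_betw_trans[OF bij_betw_trans[OF bij_betw_the_inv_into[OF r] this] y]
  have "bij_betw (?y \<circ> (p \<circ> the_inv_into {..<?n} ?r)) R Y" .
  moreover have "D i ((?y \<circ> (p \<circ> the_inv_into {..<?n} ?r)) i) \<noteq> 0" if i: "i \<in> R" for i
  proof -
    obtain k where "k < ?n" "i = ?r k"
      using r i by (auto simp: bij_betw_def)
    then show ?thesis
      using nz[of k] r by (simp add: the_inv_into_f_f bij_betw_def)
  qed
  ultimately show ?thesis by blast
qed

section \<open>Assembling the blocks\<close>

text \<open>
  Stacks the blocks. The chosen columns of a block are disjoint from those chosen later, which
  contain a zero in a later row. A kernel vector vanishes on the columns of the later blocks,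
  by induction applied to the later rows, and then on those of the current block. The constant \<open>K\<close> lifts the
  potential of the later rows above all entries of the current rows in the later columns.
\<close>

lemma block_chain_nonsingular:
  fixes A :: "'r::linorder \<Rightarrow> 'c::linorder \<Rightarrow> ereal"
  assumes entries: "order_entries A" and support: "\<And>i j. D i j \<noteq> 0 \<Longrightarrow> A i j \<noteq> - \<infinity>"
    and "finite R" "block_chain A R steps"
    and "\<And>R' X. (R', X) \<in> set steps \<Longrightarrow> \<exists>Y\<subseteq>X. card Y = card R' \<and> det (block_mat D R' Y) \<noteq> 0"
  shows "\<exists>\<sigma> l. tight_potential A R \<sigma> l \<and> det (block_mat D R (\<sigma> ` R)) \<noteq> 0"
  using assms(3-)
proof (induction steps arbitrary: R)
  case Nil
  then show ?case
    by (auto simp: tight_potential_def det_def)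
next
  case (Cons b steps)
  obtain R0 X where b: "b = (R0, X)" by fastforce
  have R0: "R0 \<subseteq> R" "finite R0" "finite (R - R0)" and X: "finite X"
    and block: "\<And>i j. i \<in> R0 \<Longrightarrow> j \<in> X \<Longrightarrow> A i j = 0 \<or> A i j = - \<infinity>"
    and below: "\<And>i j. i \<in> R - R0 \<Longrightarrow> j \<in> X \<Longrightarrow> A i j = - \<infinity>"
    and chain: "block_chain A (R - R0) steps"
    using Cons.prems(1,2) b by (auto intro: finite_subset)
  obtain \<sigma>' l' where tight': "tight_potential A (R - R0) \<sigma>' l'"
      and det': "det (block_mat D (R - R0) (\<sigma>' ` (R - R0))) \<noteq> 0"
    using Cons.IH[OF R0(3) chain] Cons.prems(3) by auto
  obtain Y0 where Y0: "Y0 \<subseteq> X" "card Y0 = card R0" "det (block_mat D R0 Y0) \<noteq> 0"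
    using Cons.prems(3)[of R0 X] b by auto
  have finY0: "finite Y0"
    using Y0(1) X by (rule finite_subset)
  obtain \<sigma>0 where \<sigma>0: "bij_betw \<sigma>0 R0 Y0" "\<And>i. i \<in> R0 \<Longrightarrow> D i (\<sigma>0 i) \<noteq> 0"
    using nonzero_transversal[OF R0(2) finY0 Y0(2,3)] by blast
  define Y' where "Y' = \<sigma>' ` (R - R0)"
  have inj': "inj_on \<sigma>' (R - R0)" and zero': "\<And>i. i \<in> R - R0 \<Longrightarrow> A i (\<sigma>' i) = 0"
    and pot': "\<And>i i'. i \<in> R - R0 \<Longrightarrow> i' \<in> R - R0 \<Longrightarrow>
      A i' (\<sigma>' i) + ereal (real (l' i')) \<le> ereal (real (l' i))"
    using tight' by (auto simp: tight_potential_def)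
  have finY': "finite Y'" and cardY': "card Y' = card (R - R0)"
    using inj' R0(3) by (auto simp: Y'_def card_image)
  have disj: "Y0 \<inter> Y' = {}"
    using Y0(1) below zero' by (force simp: Y'_def)
  have \<sigma>0X: "\<sigma>0 i \<in> X" if "i \<in> R0" for i
    using that \<sigma>0(1) Y0(1) by (auto simp: bij_betw_def)
  have zero0: "A i (\<sigma>0 i) = 0" if "i \<in> R0" for i
    using block[OF that \<sigma>0X[OF that]] support[OF \<sigma>0(2)[OF that]] by blast
  obtain K :: nat where K: "\<And>i j. i \<in> R \<Longrightarrow> j \<in> R \<Longrightarrow> A i (\<sigma>' j) \<le> ereal (real K)"
    using order_entries_bounded[OF entries finite_cartesian_product[OF Cons.prems(1,1)],
        of fst "\<lambda>e. \<sigma>' (snd e)"] by force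
  define \<sigma> where "\<sigma> i = (if i \<in> R0 then \<sigma>0 i else \<sigma>' i)" for i
  define l where "l i = (if i \<in> R0 then 0 else l' i + K)" for i
  have "bij_betw \<sigma> (R0 \<union> (R - R0)) (Y0 \<union> Y')"
  proof (rule bij_betw_combine)
    show "bij_betw \<sigma> R0 Y0"
      using \<sigma>0(1) by (rule bij_betw_cong[THEN iffD1, rotated]) (simp add: \<sigma>_def)
    have "bij_betw \<sigma>' (R - R0) Y'"
      unfolding Y'_def by (rule inj_on_imp_bij_betw[OF inj'])
    then show "bij_betw \<sigma> (R - R0) Y'"
      by (rule bij_betw_cong[THEN iffD1, rotated]) (simp add: \<sigma>_def)
  qed (rule disj)
  moreover have "R0 \<union> (R - R0) = R"
    using R0(1) by blast
  ultimately have \<sigma>: "inj_on \<sigma> R" "\<sigma> ` R = Y0 \<union> Y'"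
    by (auto simp: bij_betw_def)
  have "A i' (\<sigma> i) + ereal (real (l i')) \<le> ereal (real (l i))" if i: "i \<in> R" "i' \<in> R" for i i'
  proof (cases "i \<in> R0"; cases "i' \<in> R0")
    assume "i \<in> R0" "i' \<in> R0"
    then show ?thesis
      using block[of i' "\<sigma>0 i"] \<sigma>0X[of i] by (auto simp: \<sigma>_def l_def)
  next
    assume "i \<in> R0" "i' \<notin> R0"
    then show ?thesis
      using below[of i' "\<sigma>0 i"] \<sigma>0X[of i] i by (auto simp: \<sigma>_def l_def)
  next
    assume "i \<notin> R0" "i' \<in> R0"
    then show ?thesis
      using K[OF i(2,1)] by (cases "A i' (\<sigma>' i)") (auto simp: \<sigma>_def l_def)
  next
    assume "i \<notin> R0" "i' \<notin> R0"
    then show ?thesis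
      using pot'[of i i'] i by (cases "A i' (\<sigma>' i)") (auto simp: \<sigma>_def l_def)
  qed
  then have tight: "tight_potential A R \<sigma> l"
    using \<sigma>(1) zero0 zero' by (auto simp: tight_potential_def \<sigma>_def)
  have kernel: "\<forall>j\<in>Y0 \<union> Y'. v j = 0" if v: "\<And>i. i \<in> R \<Longrightarrow> (\<Sum>j\<in>Y0 \<union> Y'. D i j * v j) = 0" for v
  proof -
    have split: "(\<Sum>j\<in>Y0. D i j * v j) + (\<Sum>j\<in>Y'. D i j * v j) = 0" if "i \<in> R" for i
      using v[OF that] by (simp add: sum.union_disjoint finY0 finY' disj)
    have "(\<Sum>j\<in>Y'. D i j * v j) = 0" if i: "i \<in> R - R0" for i
    proof -
      have "D i j = 0" if "j \<in> Y0" for j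
        using below[OF i, of j] support[of i j] that Y0(1) by blast
      then have "(\<Sum>j\<in>Y0. D i j * v j) = 0"
        by (intro sum.neutral) simp
      then show ?thesis
        using split[of i] i by simp
    qed
    then have v': "\<forall>j\<in>Y'. v j = 0"
      using det' det_block_mat_iff_kernel[OF R0(3) finY' cardY'] unfolding Y'_def by blast
    then have "(\<Sum>j\<in>Y0. D i j * v j) = 0" if "i \<in> R0" for i
      using split[of i] that R0(1) by auto
    then have "\<forall>j\<in>Y0. v j = 0"
      using Y0(3) det_block_mat_iff_kernel[OF R0(2) finY0 Y0(2)] by blast
    with v' show ?thesis by blast
  qed
  have Y: "finite (Y0 \<union> Y')" "card (Y0 \<union> Y') = card R"
    using finY0 finY' card_image[OF \<sigma>(1)] by (simp_all add: \<sigma>(2))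
  have "det (block_mat D R (\<sigma> ` R)) \<noteq> 0"
    unfolding \<sigma>(2)
  proof (rule det_block_mat_iff_kernel[OF Cons.prems(1) Y, THEN iffD2], intro allI impI)
    show "\<forall>j\<in>Y0 \<union> Y'. v j = 0" if "\<forall>i\<in>R. (\<Sum>j\<in>Y0 \<union> Y'. D i j * v j) = 0" for v
      using that by (intro kernel) simp
  qed
  then show ?case
    using tight by blast
qed

section \<open>The truncated determinant\<close>

lemma order_entries_order_matrix: "order_entries (order_matrix U P)"
  by (auto simp: order_entries_def order_matrix_def jet_ord_def)

lemma pd_nonzero_imp_depends_on:
  assumes "open U" "\<eta> \<in> U" "pd c f \<eta> \<noteq> 0"
  shows "depends_on U f c"
proof (rule ccontr)
  assume nd: "\<not> depends_on U f c"
  let ?S = "(\<lambda>v. \<eta>(c := v)) -` U"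
  have "continuous_on UNIV (\<lambda>v. \<eta>(c := v))"
  proof (rule continuous_on_coordinatewise_then_product)
    show "continuous_on UNIV (\<lambda>v. (\<eta>(c := v)) c')" for c'
      by (cases "c' = c") simp_all
  qed
  then have S: "open ?S" "\<eta> c \<in> ?S"
    using assms(1,2) by (auto intro: open_vimage)
  have "((\<lambda>v. f \<eta>) has_field_derivative 0) (at (\<eta> c))"
    by simp
  then have "((\<lambda>v. f (\<eta>(c := v))) has_field_derivative 0) (at (\<eta> c))"
    using S
  proof (rule has_field_derivative_transform_within_open)
    show "f \<eta> = f (\<eta>(c := v))" if "v \<in> ?S" for v
      using nd that assms(2) by (auto simp: depends_on_def)
  qed
  then show False
    using assms(3) by (simp add: pd_def DERIV_imp_deriv)
qed

text \<open>
  The two matrices may differ at positions that lie on no transversal of finite order, but such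
  positions contribute to no term of the Leibniz expansion that is nonzero.
\<close>

lemma nabla_eq_jacobian_det:
  fixes P :: "nat \<Rightarrow> 'n::linorder jet \<Rightarrow> real"
  defines "D \<equiv> \<lambda>\<eta> i j. pd (Var j 0) (P i) \<eta>"
  assumes U: "open U" "\<eta> \<in> U" and tight: "tight_potential (order_matrix U P) {..<s} \<sigma> l"
  shows "nabla U s P (\<sigma> ` {..<s}) \<eta> = det (block_mat (D \<eta>) {..<s} (\<sigma> ` {..<s}))"
proof -
  define A where "A = order_matrix U P"
  define Y where "Y = \<sigma> ` {..<s}"
  let ?y = "\<lambda>k. sorted_list_of_set Y ! k" and ?\<alpha> = "canon_alpha s A Y" and ?\<beta> = "canon_beta s A Y"
  define N where "N i j = (if A i j = ereal (real (?\<alpha> i)) + ?\<beta> j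
    then pd (Var j (max_deriv U (P i) j)) (P i) \<eta> else 0)" for i j
  have tight: "tight_potential A {..<s} \<sigma> l"
    using tight by (simp add: A_def)
  have entries: "order_entries A"
    unfolding A_def by (rule order_entries_order_matrix)
  have card: "card Y = s"
    using tight_potential_bijections(2)[OF tight] by (simp add: Y_def)
  have rows: "sorted_list_of_set {..<s} ! i = i" if "i < s" for i
    using that by (simp flip: atLeast0LessThan)
  have canon: "tight_potential A {..<s} \<sigma> (minimal_canon s A Y)"
    unfolding Y_def by (rule minimal_canon_tight_potential[OF entries tight])
  have \<beta>: "?\<beta> j \<noteq> - \<infinity>" if "j \<in> Y" for j
    using that canon_beta_tight[OF canon] by (auto simp: Y_def)
  have prods: "(\<Prod>i = 0..<s. N i (?y (p i))) = (\<Prod>i = 0..<s. D \<eta> i (?y (p i)))"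
    if p: "p permutes {0..<s}" for p
  proof -
    define \<tau> where "\<tau> i = ?y (p i)" for i
    have "bij_betw (?y \<circ> p) {..<s} Y"
      using permutes_imp_bij[OF p] bij_betw_sorted_list_of_set[of Y] card
      by (intro bij_betw_trans[of p _ "{..<s}"]) (auto simp: atLeast0LessThan Y_def)
    then have \<tau>: "bij_betw \<tau> {..<s} Y"
      by (simp add: \<tau>_def[abs_def] comp_def)
    show ?thesis
    proof (cases "\<exists>i<s. A i (\<tau> i) = - \<infinity>")
      case True
      then obtain i where i: "i < s" "A i (\<tau> i) = - \<infinity>" by blast
      have "\<tau> i \<in> Y"
        using \<tau> i(1) by (auto simp: bij_betw_def)
      then have "N i (\<tau> i) = 0"
        using i(2) \<beta>[of "\<tau> i"] by (auto simp: N_def)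
      moreover have "D \<eta> i (\<tau> i) = 0"
        using i(2) pd_nonzero_imp_depends_on[OF U, of "Var (\<tau> i) 0" "P i"]
        by (auto simp: A_def order_matrix_def jet_ord_def D_def split: if_splits)
      ultimately show ?thesis
        using i(1) by (auto simp: \<tau>_def intro!: prod_zero[THEN trans] prod_zero[symmetric])
    next
      case False
      then have tight_\<tau>: "tight_potential A {..<s} \<tau> (minimal_canon s A Y)"
        using \<tau> by (intro tight_potential_transfer[OF entries _ canon]) (auto simp: Y_def)
      have "N i (\<tau> i) = D \<eta> i (\<tau> i)" if i: "i < s" for i
      proof -
        have "A i (\<tau> i) = 0"
          using tight_\<tau> i by (simp add: tight_potential_def)
        moreover from this have "max_deriv U (P i) (\<tau> i) = 0"
          by (auto simp: A_def order_matrix_def jet_ord_def zero_ereal_def split: if_splits)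
        ultimately show ?thesis
          by (simp add: N_def D_def canon_beta_tight[OF tight_\<tau> i])
      qed
      then show ?thesis
        by (intro prod.cong) (auto simp: \<tau>_def)
    qed
  qed
  have "nabla U s P Y \<eta> = det (mat s s (\<lambda>(i, k). N i (?y k)))"
    by (simp add: nabla_def Let_def N_def A_def)
  also have "\<dots> = (\<Sum>p | p permutes {0..<s}. signof p * (\<Prod>i = 0..<s. N i (?y (p i))))"
    unfolding det_def by (auto intro!: sum.cong prod.cong simp: permutes_in_image)
  also have "\<dots> = (\<Sum>p | p permutes {0..<s}. signof p * (\<Prod>i = 0..<s. D \<eta> i (?y (p i))))"
    using prods by (intro sum.cong) auto
  also have "\<dots> = det (block_mat (D \<eta>) {..<s} Y)"
    unfolding det_def by (auto intro!: sum.cong prod.cong simp: permutes_in_image card rows)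
  finally show ?thesis
    by (simp add: Y_def)
qed

theorem theorem57:
  fixes U :: "'n::{finite,linorder} jet set"
    and P :: "nat \<Rightarrow> 'n jet \<Rightarrow> real"
    and s :: nat
    and \<eta> :: "'n jet"
  assumes "differential_system U s P"
    and "\<eta> \<in> diffiety U s P"
    and "obar_system U s P"
    and "\<And>h. 1 \<le> h \<Longrightarrow> h \<le> length (obar_steps U s P) \<Longrightarrow>
           jacobian_rank P (Sigma_block (obar_steps U s P) h) (Xi_block (obar_steps U s P) h) \<eta>
             = card (Sigma_block (obar_steps U s P) h)"
  shows "obar_regular U s P \<eta>"
proof -
  define A where "A = order_matrix U P"
  define D where "D i j = pd (Var j 0) (P i) \<eta>" for i j
  let ?steps = "obar_steps U s P"
  have U: "open U" "\<eta> \<in> U"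
    using assms(1,2) by (auto simp: differential_system_def diffiety_def)
  have entries: "order_entries A"
    unfolding A_def by (rule order_entries_order_matrix)
  obtain \<sigma>\<^sub>0 l\<^sub>0 where "tight_potential A {..<s} \<sigma>\<^sub>0 l\<^sub>0"
    using zero_saddle_number_tight_potential[OF entries] assms(3) unfolding obar_system_def A_def by blast
  from obar_test_succeeds[OF _ _ entries this, of UNIV]
  have chain: "block_chain A {..<s} ?steps"
    by (auto simp: obar_steps_def A_def)
  have rows: "R' \<subseteq> R" if "block_chain A R bs" "(R', X) \<in> set bs" for R R' X and bs :: "(nat set \<times> 'n set) list"
    using that by (induction bs arbitrary: R) auto
  \<comment> \<open>A nonzero derivative at \<open>\<eta>\<close> forces a finite order, possibly positive.\<close>
  have support: "A i j \<noteq> - \<infinity>" if "D i j \<noteq> 0" for i j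
    using pd_nonzero_imp_depends_on[OF U, of "Var j 0" "P i"] that
    by (auto simp: D_def A_def order_matrix_def jet_ord_def)
  have minors: "\<exists>Y\<subseteq>X. card Y = card R \<and> det (block_mat D R Y) \<noteq> 0"
    if step: "(R, X) \<in> set ?steps" for R X
  proof (rule full_row_rank_minor)
    obtain k where k: "k < length ?steps" "?steps ! k = (R, X)"
      using step by (auto simp: in_set_conv_nth)
    then have "Sigma_block ?steps (length ?steps - k) = R" "Xi_block ?steps (length ?steps - k) = X"
      by (simp_all add: Sigma_block_def Xi_block_def)
    then show "vec_space.rank (card R) (block_mat D R X) = card R"
      using assms(4)[of "length ?steps - k"] k(1) by (simp add: jacobian_rank_def D_def)
    show "finite R"
      using rows[OF chain step] by (rule finite_subset) simp
    show "finite X" by simp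
  qed
  obtain \<sigma> l where tight: "tight_potential A {..<s} \<sigma> l"
      and det: "det (block_mat D {..<s} (\<sigma> ` {..<s})) \<noteq> 0"
    using block_chain_nonsingular[where A = A and D = D, OF entries support _ chain minors] by blast
  have "nabla U s P (\<sigma> ` {..<s}) \<eta> \<noteq> 0"
    using nabla_eq_jacobian_det[OF U tight[unfolded A_def]] det by (simp add: D_def[abs_def])
  then show ?thesis
    unfolding obar_regular_def
    using assms(3) jacobi_number_tight_potential[OF entries tight] tight_potential_bijections(2)[OF tight]
    by (auto simp: A_def intro!: exI[of _ "\<sigma> ` {..<s}"])
qed

end
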